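(* Let $n=p+q$ with $p\ge q$. For any complex (resp. quaternionic) $n\times n$ invertible matrix $G$, there exist an $n\times n$ complex (resp. quaternionic) unitary matrix $U$, two complex (resp. quaternionic) invertible matrices $G_p\in\mathrm{GL}(p,\mathbb{C})$ and $G_q\in\mathrm{GL}(q,\mathbb{C})$ (resp. $G_p\in\mathrm{GL}(p,\mathbb{H})$ and $G_q\in\mathrm{GL}(q,\mathbb{H})$), and $q$ unique (up to order and signs) real numbers $\theta_1,\dots,\theta_q$ such that $$G = U\begin{bmatrix} Ch & 0 & Sh\\ 0 & I_{p-q} & 0\\ Sh & 0 & Ch\end{bmatrix}\begin{bmatrix} G_p & 0\\ 0& G_q\end{bmatrix}.$$
   Context: $\mathbb{H}$ denotes the real quaternions. A quaternionic matrix $U\in\mathbb{H}^{n\times n}$ is unitary if $U^DU=I_n$, where $(U^D)_{ab}=\overline{U_{ba}}$ is the quaternionic conjugate transpose. $Ch=\operatorname{diag}(\cosh\theta_1,\dots,\cosh\theta_q)$ and $Sh=\operatorname{diag}(\sinh\theta_1,\dots,\sinh\theta_q)$ are $q\times q$ diagonal matrices. The block sizes of the middle factor are $q,\,p-q,\,q$. *)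

theory Defs
  imports Complex_Main "HOL-Combinatorics.Permutations" "Jordan_Normal_Form.Matrix"
begin

section \<open>The real quaternions\<close>

text \<open>\<open>Quat a b c d\<close> stands for a + b i + c j + d k.\<close>

datatype quaternion = Quat (qRe: real) (qI: real) (qJ: real) (qK: real)

lemma quaternion_eq_iff:
  "x = y \<longleftrightarrow> qRe x = qRe y \<and> qI x = qI y \<and> qJ x = qJ y \<and> qK x = qK y"
  by (rule quaternion.expand[THEN iffI[rotated]]) auto

instantiation quaternion :: real_div_algebra
begin

definition "0 = Quat 0 0 0 0"
definition "1 = Quat 1 0 0 0"
definition "x + y = Quat (qRe x + qRe y) (qI x + qI y) (qJ x + qJ y) (qK x + qK y)"
definition "- x = Quat (- qRe x) (- qI x) (- qJ x) (- qK x)"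
definition "x - y = Quat (qRe x - qRe y) (qI x - qI y) (qJ x - qJ y) (qK x - qK y)"
definition "r *\<^sub>R x = Quat (r * qRe x) (r * qI x) (r * qJ x) (r * qK x)"

definition "x * y = Quat
  (qRe x * qRe y - qI x * qI y - qJ x * qJ y - qK x * qK y)
  (qRe x * qI y + qI x * qRe y + qJ x * qK y - qK x * qJ y)
  (qRe x * qJ y - qI x * qK y + qJ x * qRe y + qK x * qI y)
  (qRe x * qK y + qI x * qJ y - qJ x * qI y + qK x * qRe y)"

definition "inverse x =
  (let s = (qRe x)\<^sup>2 + (qI x)\<^sup>2 + (qJ x)\<^sup>2 + (qK x)\<^sup>2
   in Quat (qRe x / s) (- qI x / s) (- qJ x / s) (- qK x / s))"

definition "x div y = x * inverse (y :: quaternion)"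

lemmas quaternion_defs =
  zero_quaternion_def one_quaternion_def plus_quaternion_def uminus_quaternion_def
  minus_quaternion_def scaleR_quaternion_def times_quaternion_def

lemma quaternion_sumsq_neq_0:
  assumes "x \<noteq> (0 :: quaternion)"
  shows "(qRe x)\<^sup>2 + (qI x)\<^sup>2 + (qJ x)\<^sup>2 + (qK x)\<^sup>2 \<noteq> 0"
  using assms
  by (auto simp: quaternion_eq_iff zero_quaternion_def add_nonneg_eq_0_iff)

lemma quaternion_inverses:
  assumes "x \<noteq> (0 :: quaternion)"
  shows "inverse x * x = 1" "x * inverse x = 1"
proof -
  define s where "s = (qRe x)\<^sup>2 + (qI x)\<^sup>2 + (qJ x)\<^sup>2 + (qK x)\<^sup>2"
  have "s \<noteq> 0"
    using quaternion_sumsq_neq_0[OF assms] by (simp add: s_def)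
  then have s: "qRe x * qRe x / s + qI x * qI x / s + qJ x * qJ x / s + qK x * qK x / s = 1"
    by (simp add: s_def power2_eq_square add_divide_distrib[symmetric])
  show "inverse x * x = 1" "x * inverse x = 1"
    using s by (simp_all add: inverse_quaternion_def Let_def s_def[symmetric] quaternion_eq_iff
      times_quaternion_def one_quaternion_def mult.commute)
qed

instance
proof
  fix x y :: quaternion
  show "x \<noteq> 0 \<Longrightarrow> inverse x * x = 1" "x \<noteq> 0 \<Longrightarrow> x * inverse x = 1"
    by (rule quaternion_inverses, assumption)+
  show "x div y = x * inverse y"
    by (rule divide_quaternion_def)
  show "inverse (0 :: quaternion) = 0"
    by (simp add: inverse_quaternion_def zero_quaternion_def)
qed (auto simp: quaternion_eq_iff quaternion_defs algebra_simps)

end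

instantiation quaternion :: conjugate
begin

definition "conjugate x = Quat (qRe x) (- qI x) (- qJ x) (- qK x)"

instance
  by standard (auto simp: conjugate_quaternion_def quaternion_eq_iff)

end

section \<open>Matrices over the complex numbers or the quaternions\<close>

text \<open>
  The library's adjoint of a matrix is restricted to commutative fields. The following
  definition needs only the class \<open>conjugate\<close>, in which conjugation is not required to
  preserve products (on quaternions it reverses them).
\<close>

definition conj_transpose :: "'a :: conjugate mat \<Rightarrow> 'a mat" where
  "conj_transpose A = map_mat conjugate (transpose_mat A)"

definition unitary_group :: "nat \<Rightarrow> 'a :: {conjugate, semiring_1} mat set" where
  "unitary_group n = {U \<in> carrier_mat n n. conj_transpose U * U = 1\<^sub>m n}"

definition general_linear :: "nat \<Rightarrow> 'a :: semiring_1 mat set" where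
  "general_linear n = {A \<in> carrier_mat n n. invertible_mat A}"

definition Ch :: "nat \<Rightarrow> (nat \<Rightarrow> real) \<Rightarrow> 'a :: real_algebra_1 mat" where
  "Ch q \<theta> = mat_diag q (\<lambda>i. of_real (cosh (\<theta> i)))"

definition Sh :: "nat \<Rightarrow> (nat \<Rightarrow> real) \<Rightarrow> 'a :: real_algebra_1 mat" where
  "Sh q \<theta> = mat_diag q (\<lambda>i. of_real (sinh (\<theta> i)))"

text \<open>
  The block rows and columns have sizes q, p - q, q. The outer partition is p + q: the top left
  block is [Ch, 0; 0, I], the top right one is the column [Sh; 0] and the bottom left one the
  row [Sh, 0].
\<close>

definition hyperbolic_mat :: "nat \<Rightarrow> nat \<Rightarrow> (nat \<Rightarrow> real) \<Rightarrow> 'a :: real_algebra_1 mat" where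
  "hyperbolic_mat p q \<theta> =
     four_block_mat
       (four_block_mat (Ch q \<theta>) (0\<^sub>m q (p - q)) (0\<^sub>m (p - q) q) (1\<^sub>m (p - q)))
       (Sh q \<theta> @\<^sub>r 0\<^sub>m (p - q) q)
       (transpose_mat (Sh q \<theta> @\<^sub>r 0\<^sub>m (p - q) q))
       (Ch q \<theta>)"

lemma hyperbolic_mat_index:
  assumes "q \<le> p" "i < p + q" "j < p + q"
  shows "hyperbolic_mat p q \<theta> $$ (i, j) =
    (if i = j then (if i < q then of_real (cosh (\<theta> i))
                    else if i < p then 1 else of_real (cosh (\<theta> (i - p))))
     else if j = i + p then of_real (sinh (\<theta> i))
     else if i = j + p then of_real (sinh (\<theta> j)) else 0)"
  using assms
  by (auto simp: hyperbolic_mat_def Ch_def Sh_def mat_diag_def append_rows_def)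

definition hyperbolic_decomposition ::
    "nat \<Rightarrow> nat \<Rightarrow> 'a :: {conjugate, real_algebra_1} mat \<Rightarrow> (nat \<Rightarrow> real) \<Rightarrow>
     'a mat \<Rightarrow> 'a mat \<Rightarrow> 'a mat \<Rightarrow> bool" where
  "hyperbolic_decomposition p q G \<theta> U Gp Gq \<longleftrightarrow>
     U \<in> unitary_group (p + q) \<and> Gp \<in> general_linear p \<and> Gq \<in> general_linear q \<and>
     G = U * hyperbolic_mat p q \<theta> * four_block_mat Gp (0\<^sub>m p q) (0\<^sub>m q p) Gq"

text \<open>The q-tuple of real numbers is represented by the values of a function on \<open>{..<q}\<close>;
  its values elsewhere are irrelevant.\<close>

definition eq_up_to_order_and_signs :: "nat \<Rightarrow> (nat \<Rightarrow> real) \<Rightarrow> (nat \<Rightarrow> real) \<Rightarrow> bool" where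
  "eq_up_to_order_and_signs q \<theta> \<theta>' \<longleftrightarrow>
     (\<exists>\<pi>. \<pi> permutes {..<q} \<and> (\<forall>i<q. \<theta>' i = \<theta> (\<pi> i) \<or> \<theta>' i = - \<theta> (\<pi> i)))"

end

theory Submission
  imports Defs "Jordan_Normal_Form.Gauss_Jordan_Elimination"
begin

text \<open>
  Split the columns of G into blocks of sizes p and q, spanning subspaces V and W. Bases of V and W
  can be chosen orthonormal and such that their mutual Gram matrix is diagonal with entries
  c(i) in (-1, 1) (principal vectors, obtained one pair at a time from the largest eigenvalue of
  a Hermitian pencil). Rescaling by sqrt (cosh (2\<theta>(i))), where tanh (2\<theta>(i)) = c(i), turns the Gram
  matrix into the square of the hyperbolic matrix H(\<theta>), and this is the decomposition.

  For uniqueness, let J = diag(I, -I) and let K be the block diagonal factor, so that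
  M = G^D G = K^D H(2\<theta>) K. Since J H(\<theta>) J = H(-\<theta>) and J commutes with K, the inverse of JMJ times M is
  the conjugate of H(4\<theta>) by K. Adding the analogous formula for H(-4\<theta>), the matrix
  H(4\<theta>) + H(-4\<theta>), which is diagonal with entries 2 cosh (4\<theta>(i)) and 2, is determined up to
  conjugation by a block diagonal matrix.
\<close>

section \<open>Division algebras with a positive involution\<close>

text \<open>What survives is that real scalars are central. Hence eigenvalues come from a
  real-valued variational problem, and in the uniqueness part multiplicities are compared through
  the zero pattern of an intertwining matrix. Invertibility of \<open>G\<close> enters existence as
  strict positivity of the combined form on pairs of columns; this is what keeps the numbers c(i)
  strictly between -1 and 1 and makes them values of tanh. The parameters double twice. Forming the
  Gram matrix gives 2\<theta>, but two Gram matrices are then related only by a congruence, which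
  does not preserve eigenvalues. Combining the congruences for 2\<theta> and -2\<theta> yields a
  similarity, at the price of 4\<theta>. Adding the similarity for the opposite sign cancels the
  sinh blocks and leaves real diagonal blocks, which can be compared entry by entry. Evenness of
  cosh is the source of the sign ambiguity.\<close>

text \<open>This class is what the complex and the quaternionic case have in common.\<close>

class star_division = real_div_algebra + conjugate +
  assumes conjugate_add: "conjugate (x + y) = conjugate x + conjugate y"
    and conjugate_mult: "conjugate (x * y) = conjugate y * conjugate x"
    and conjugate_scaleR: "conjugate (r *\<^sub>R x) = r *\<^sub>R conjugate x"
    and conjugate_mult_self: "\<exists>r\<ge>0. conjugate x * x = r *\<^sub>R 1"

instance complex :: star_division
proof
  fix x y :: complex and r :: real
  show "conjugate (x + y) = conjugate x + conjugate y" "conjugate (x * y) = conjugate y * conjugate x"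
    "conjugate (r *\<^sub>R x) = r *\<^sub>R conjugate x"
    by simp_all
  show "\<exists>r\<ge>0. conjugate x * x = r *\<^sub>R 1"
    by (rule exI[of _ "(cmod x)\<^sup>2"]) (simp add: complex_norm_square[symmetric] scaleR_conv_of_real mult.commute)
qed

instance quaternion :: star_division
proof
  fix x y :: quaternion and r :: real
  show "conjugate (x + y) = conjugate x + conjugate y" "conjugate (x * y) = conjugate y * conjugate x"
    "conjugate (r *\<^sub>R x) = r *\<^sub>R conjugate x"
    by (simp_all add: conjugate_quaternion_def quaternion_eq_iff quaternion_defs algebra_simps)
  show "\<exists>r\<ge>0. conjugate x * x = r *\<^sub>R 1"
    by (rule exI[of _ "(qRe x)\<^sup>2 + (qI x)\<^sup>2 + (qJ x)\<^sup>2 + (qK x)\<^sup>2"])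
      (simp add: quaternion_defs conjugate_quaternion_def quaternion_eq_iff power2_eq_square)
qed

text \<open>The class carries no real-part operation. The trace \<open>x + conjugate x\<close> turns
  out to be real (\<open>add_conjugate\<close>), which makes the chosen number exist; it is unique
  because \<open>of_real\<close> is injective.\<close>

definition real_part :: "'a :: star_division \<Rightarrow> real" where
  "real_part x = (SOME r. x + conjugate x = of_real (2 * r))"

lemma conjugate_0 [simp]: "conjugate (0 :: 'a :: star_division) = 0"
  using conjugate_scaleR[of 0 "0 :: 'a"] by simp

lemma conjugate_minus: "conjugate (- x) = - conjugate (x :: 'a :: star_division)"
  using conjugate_scaleR[of "-1" x] by simp

lemma conjugate_diff: "conjugate (x - y) = conjugate x - conjugate (y :: 'a :: star_division)"
  using conjugate_add[of x "- y"] by (simp add: conjugate_minus)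

lemma conjugate_1 [simp]: "conjugate (1 :: 'a :: star_division) = 1"
  using conjugate_mult[of "conjugate 1" "1 :: 'a"] by simp

lemma conjugate_of_real [simp]: "conjugate (of_real r :: 'a :: star_division) = of_real r"
  by (simp add: of_real_def conjugate_scaleR)

lemma conjugate_sum: "conjugate (sum f A) = (\<Sum>i\<in>A. conjugate (f i :: 'a :: star_division))"
  by (induction A rule: infinite_finite_induct) (simp_all add: conjugate_add)

text \<open>Polarisation: the norms of \<open>1 + x\<close> and \<open>x\<close> are real by the
  class axiom, and they differ by 1 plus the trace of \<open>x\<close>.\<close>

lemma add_conjugate: "x + conjugate x = of_real (2 * real_part (x :: 'a :: star_division))"
proof -
  obtain a where a: "conjugate (1 + x) * (1 + x) = of_real a"
    using conjugate_mult_self unfolding of_real_def by blast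
  obtain b where b: "conjugate x * x = of_real b"
    using conjugate_mult_self unfolding of_real_def by blast
  have "x + conjugate x = conjugate (1 + x) * (1 + x) - 1 - conjugate x * x"
    by (simp add: conjugate_add algebra_simps)
  also have "\<dots> = of_real (2 * ((a - 1 - b) / 2))"
    by (simp only: a b of_real_diff of_real_1 mult_2 field_sum_of_halves)
  finally show ?thesis
    unfolding real_part_def by (rule someI)
qed

lemma real_part_eqI: "x + conjugate x = of_real (2 * r) \<Longrightarrow> real_part (x :: 'a :: star_division) = r"
  using add_conjugate[of x] by (simp del: of_real_mult)

lemma real_part_of_real [simp]: "real_part (of_real r :: 'a :: star_division) = r"
  by (rule real_part_eqI) (simp only: conjugate_of_real of_real_add[symmetric] mult_2)

lemma real_part_0 [simp]: "real_part (0 :: 'a :: star_division) = 0"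
  using real_part_of_real[of 0] by simp

lemma real_part_add: "real_part (x + y) = real_part x + real_part (y :: 'a :: star_division)"
proof (rule real_part_eqI)
  have "x + y + conjugate (x + y) = (x + conjugate x) + (y + conjugate y)"
    by (simp add: conjugate_add algebra_simps)
  then show "x + y + conjugate (x + y) = of_real (2 * (real_part x + real_part y))"
    by (simp only: add_conjugate of_real_add[symmetric] distrib_left)
qed

lemma real_part_of_real_mult:
  "real_part (of_real r * x) = r * real_part (x :: 'a :: star_division)"
proof (rule real_part_eqI)
  have "of_real r * x + conjugate (of_real r * x) = of_real r * (x + conjugate x)"
    by (simp add: of_real_def conjugate_scaleR scaleR_add_right)
  then show "of_real r * x + conjugate (of_real r * x) = of_real (2 * (r * real_part x))"
    by (simp only: add_conjugate of_real_mult[symmetric] mult.left_commute)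
qed

lemma real_part_minus: "real_part (- x) = - real_part (x :: 'a :: star_division)"
  using real_part_of_real_mult[of "-1" x] by simp

lemma real_part_diff: "real_part (x - y) = real_part x - real_part (y :: 'a :: star_division)"
  using real_part_add[of x "- y"] by (simp add: real_part_minus)

lemma real_part_sum: "real_part (sum f A) = (\<Sum>i\<in>A. real_part (f i :: 'a :: star_division))"
  by (induction A rule: infinite_finite_induct) (simp_all add: real_part_add)

lemma real_part_conjugate: "real_part (conjugate x) = real_part (x :: 'a :: star_division)"
  by (rule real_part_eqI) (use add_conjugate[of x] in \<open>simp add: add.commute\<close>)

lemma of_real_real_part:
  assumes "conjugate x = (x :: 'a :: star_division)"
  shows "of_real (real_part x) = x"
proof -
  have "2 * x = 2 * of_real (real_part x)"
    using add_conjugate[of x] assms by (simp only: mult_2 of_real_add)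
  then show ?thesis by simp
qed

definition sq_abs :: "'a :: star_division \<Rightarrow> real" where
  "sq_abs x = real_part (conjugate x * x)"

lemma conjugate_mult_self_eq: "conjugate x * x = of_real (sq_abs (x :: 'a :: star_division))"
  unfolding sq_abs_def by (rule of_real_real_part[symmetric]) (simp add: conjugate_mult)

lemma sq_abs_nonneg [simp]: "sq_abs (x :: 'a :: star_division) \<ge> 0"
  using conjugate_mult_self[of x] by (auto simp: sq_abs_def simp flip: of_real_def)

lemma sq_abs_eq_0_iff [simp]: "sq_abs x = 0 \<longleftrightarrow> (x :: 'a :: star_division) = 0"
proof -
  have "conjugate x = 0 \<longleftrightarrow> x = 0"
    using conjugate_cancel_iff[of x 0] by simp
  then have "conjugate x * x = 0 \<longleftrightarrow> x = 0"
    by auto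
  then show ?thesis
    by (simp add: conjugate_mult_self_eq)
qed

text \<open>Noncommutativity does no harm: the inner factor \<open>conjugate x * x\<close> is real,
  hence central, and can be pulled out.\<close>

lemma sq_abs_mult: "sq_abs (x * y) = sq_abs x * sq_abs (y :: 'a :: star_division)"
proof -
  have "conjugate (x * y) * (x * y) = conjugate y * (conjugate x * x) * y"
    by (simp add: conjugate_mult mult.assoc)
  also have "\<dots> = of_real (sq_abs x) * (conjugate y * y)"
    by (simp add: conjugate_mult_self_eq of_real_def)
  also have "\<dots> = of_real (sq_abs x * sq_abs y)"
    by (simp add: conjugate_mult_self_eq)
  finally show ?thesis
    unfolding sq_abs_def[of "x * y"] by (simp del: of_real_mult)
qed

text \<open>Expansion of \<open>sq_abs (x - y)\<close>, which is nonnegative.\<close>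

lemma two_real_part_mult_le:
  "2 * real_part (conjugate x * y) \<le> sq_abs x + sq_abs (y :: 'a :: star_division)"
proof -
  have "conjugate (x - y) * (x - y) = conjugate x * x + conjugate y * y
      - (conjugate x * y + conjugate (conjugate x * y))"
    by (simp add: conjugate_diff conjugate_mult algebra_simps)
  then have "real_part (conjugate (x - y) * (x - y)) = real_part (conjugate x * x + conjugate y * y
      - (conjugate x * y + conjugate (conjugate x * y)))" by simp
  then have "sq_abs (x - y) = sq_abs x + sq_abs y - 2 * real_part (conjugate x * y)"
    by (simp only: sq_abs_def real_part_add real_part_diff real_part_conjugate)
  then show ?thesis
    using sq_abs_nonneg[of "x - y"] by linarith
qed

section \<open>Matrices\<close>

text \<open>Stated with equations between dimensions rather than carrier sets, so that it serves as
  a rewrite rule without undetermined sizes.\<close>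

lemma mult_mat_assoc:
  fixes A :: "'a :: semiring_0 mat"
  assumes "dim_col A = dim_row B" "dim_col B = dim_row C"
  shows "A * B * C = A * (B * C)"
  using assms by (intro assoc_mult_mat) auto

lemma dim_conj_transpose [simp]:
  "dim_row (conj_transpose A) = dim_col A" "dim_col (conj_transpose A) = dim_row A"
  by (simp_all add: conj_transpose_def)

lemma conj_transpose_carrier [simp]:
  "conj_transpose A \<in> carrier_mat m n \<longleftrightarrow> A \<in> carrier_mat n m"
  unfolding carrier_mat_def by auto

lemma index_conj_transpose [simp]:
  "i < dim_col A \<Longrightarrow> j < dim_row A \<Longrightarrow> conj_transpose A $$ (i, j) = conjugate (A $$ (j, i))"
  by (simp add: conj_transpose_def)

lemma conj_transpose_conj_transpose [simp]: "conj_transpose (conj_transpose A) = A"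
  by (rule eq_matI) auto

lemma conj_transpose_mult:
  fixes A :: "'a :: star_division mat"
  assumes "dim_col A = dim_row B"
  shows "conj_transpose (A * B) = conj_transpose B * conj_transpose A"
  using assms
  by (intro eq_matI) (auto simp: scalar_prod_def conjugate_sum conjugate_mult intro!: sum.cong)

lemma conj_transpose_one [simp]: "conj_transpose (1\<^sub>m n) = (1\<^sub>m n :: 'a :: star_division mat)"
  by (rule eq_matI) auto

lemma conj_transpose_zero [simp]: "conj_transpose (0\<^sub>m m n) = (0\<^sub>m n m :: 'a :: star_division mat)"
  by (rule eq_matI) auto

definition real_smult :: "real \<Rightarrow> 'a :: star_division mat \<Rightarrow> 'a mat" where
  "real_smult r A = of_real r \<cdot>\<^sub>m A"

lemma dim_real_smult [simp]:
  "dim_row (real_smult r A) = dim_row A" "dim_col (real_smult r A) = dim_col A"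
  by (simp_all add: real_smult_def)

lemma real_smult_carrier [simp]: "real_smult r A \<in> carrier_mat m n \<longleftrightarrow> A \<in> carrier_mat m n"
  unfolding carrier_mat_def by auto

lemma index_real_smult [simp]:
  "i < dim_row A \<Longrightarrow> j < dim_col A \<Longrightarrow> real_smult r A $$ (i, j) = of_real r * A $$ (i, j)"
  by (simp add: real_smult_def)

lemma conj_transpose_real_smult:
  "conj_transpose (real_smult r A) = real_smult r (conj_transpose A)"
  by (rule eq_matI) (auto simp: of_real_def conjugate_scaleR)

lemma real_smult_mult_left:
  "dim_col A = dim_row B \<Longrightarrow> real_smult r A * B = real_smult r (A * B)"
  by (rule eq_matI) (auto simp: scalar_prod_def sum_distrib_left mult.assoc)

lemma real_smult_mult_right:
  "dim_col A = dim_row B \<Longrightarrow> A * real_smult r B = real_smult r (A * B)"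
  by (rule eq_matI) (auto simp: scalar_prod_def of_real_def scaleR_right.sum)

lemma real_smult_real_smult: "real_smult r (real_smult s A) = real_smult (r * s) A"
  by (rule eq_matI) (auto simp: mult.assoc)

lemma real_smult_1 [simp]: "real_smult 1 A = A"
  by (rule eq_matI) auto

lemma real_smult_0: "A \<in> carrier_mat m n \<Longrightarrow> real_smult 0 A = 0\<^sub>m m n"
  by (rule eq_matI) auto

text \<open>For a column \<open>x\<close> of length \<open>n\<close>, the sum \<open>0\<^sub>m 1 0 \<oplus> x\<close> is the column \<open>(0; x)\<close>.\<close>

definition direct_sum :: "'a :: zero mat \<Rightarrow> 'a mat \<Rightarrow> 'a mat" where
  "direct_sum A B =
     four_block_mat A (0\<^sub>m (dim_row A) (dim_col B)) (0\<^sub>m (dim_row B) (dim_col A)) B"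

lemma dim_direct_sum [simp]:
  "dim_row (direct_sum A B) = dim_row A + dim_row B"
  "dim_col (direct_sum A B) = dim_col A + dim_col B"
  by (simp_all add: direct_sum_def)

lemma direct_sum_carrier [simp]:
  "A \<in> carrier_mat m n \<Longrightarrow> B \<in> carrier_mat k l \<Longrightarrow> direct_sum A B \<in> carrier_mat (m + k) (n + l)"
  unfolding carrier_mat_def by auto

lemma direct_sum_mult:
  fixes A B :: "'a :: semiring_0 mat"
  assumes "dim_col A = dim_row A'" "dim_col B = dim_row B'"
  shows "direct_sum A B * direct_sum A' B' = direct_sum (A * A') (B * B')"
  using assms unfolding direct_sum_def
  by (subst mult_four_block_mat[of _ "dim_row A" "dim_col A" _ "dim_col B" _ "dim_row B"
        _ _ "dim_col A'" _ "dim_col B'"]) auto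

lemma conj_transpose_direct_sum:
  "conj_transpose (direct_sum A B) = direct_sum (conj_transpose A) (conj_transpose (B :: 'a :: star_division mat))"
  by (rule eq_matI) (auto simp: direct_sum_def)

lemma direct_sum_one: "direct_sum (1\<^sub>m m) (1\<^sub>m n) = 1\<^sub>m (m + n)"
  by (simp add: direct_sum_def)

lemma direct_sum_empty_left: "direct_sum (0\<^sub>m 0 0) A = A"
  by (rule eq_matI) (auto simp: direct_sum_def)

lemma direct_sum_mult_four_block_mat:
  fixes A B C D S T :: "'a :: semiring_1 mat"
  assumes "A \<in> carrier_mat m k" "B \<in> carrier_mat m l" "C \<in> carrier_mat n k" "D \<in> carrier_mat n l"
    and "S \<in> carrier_mat m' m" "T \<in> carrier_mat n' n"
  shows "direct_sum S T * four_block_mat A B C D = four_block_mat (S * A) (S * B) (T * C) (T * D)"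
proof -
  have "direct_sum S T * four_block_mat A B C D = four_block_mat (S * A + 0\<^sub>m m' n * C)
      (S * B + 0\<^sub>m m' n * D) (0\<^sub>m n' m * A + T * C) (0\<^sub>m n' m * B + T * D)"
    unfolding direct_sum_def using assms by (subst mult_four_block_mat[of _ m' m _ n _ n']) auto
  moreover have "S * A \<in> carrier_mat m' k" "S * B \<in> carrier_mat m' l"
      "T * C \<in> carrier_mat n' k" "T * D \<in> carrier_mat n' l"
    using assms by auto
  ultimately show ?thesis using assms by simp
qed

lemma four_block_mat_mult_direct_sum:
  fixes A B C D S T :: "'a :: semiring_1 mat"
  assumes "A \<in> carrier_mat k m" "B \<in> carrier_mat k n" "C \<in> carrier_mat l m" "D \<in> carrier_mat l n"
    and "S \<in> carrier_mat m m'" "T \<in> carrier_mat n n'"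
  shows "four_block_mat A B C D * direct_sum S T = four_block_mat (A * S) (B * T) (C * S) (D * T)"
proof -
  have "four_block_mat A B C D * direct_sum S T = four_block_mat (A * S + B * 0\<^sub>m n m')
      (A * 0\<^sub>m m n' + B * T) (C * S + D * 0\<^sub>m n m') (C * 0\<^sub>m m n' + D * T)"
    unfolding direct_sum_def using assms by (subst mult_four_block_mat[of _ k m _ n _ l]) auto
  moreover have "A * S \<in> carrier_mat k m'" "B * T \<in> carrier_mat k n'"
      "C * S \<in> carrier_mat l m'" "D * T \<in> carrier_mat l n'"
    using assms by auto
  ultimately show ?thesis using assms by simp
qed

text \<open>Rectangular matrices are allowed so that the sinh blocks, of sizes p by q and q by p,
  follow the same rules as the square cosh blocks.\<close>

definition real_diag :: "nat \<Rightarrow> nat \<Rightarrow> (nat \<Rightarrow> real) \<Rightarrow> 'a :: star_division mat" where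
  "real_diag m n c = mat m n (\<lambda>(i, j). if i = j then of_real (c i) else 0)"

lemma dim_real_diag [simp]:
  "dim_row (real_diag m n c) = m" "dim_col (real_diag m n c) = n"
  by (simp_all add: real_diag_def)

lemma real_diag_carrier [simp]: "real_diag m n c \<in> carrier_mat m n"
  by (simp add: real_diag_def)

lemma real_diag_cong:
  "(\<And>i. i < m \<Longrightarrow> i < n \<Longrightarrow> c i = d i) \<Longrightarrow> real_diag m n c = real_diag m n d"
  by (rule eq_matI) (auto simp: real_diag_def)

lemma conj_transpose_real_diag [simp]: "conj_transpose (real_diag m n c) = real_diag n m c"
  by (rule eq_matI) (auto simp: real_diag_def)

lemma real_diag_one: "real_diag n n (\<lambda>_. 1) = 1\<^sub>m n"
  by (rule eq_matI) (auto simp: real_diag_def)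

lemma real_diag_zero: "real_diag m n (\<lambda>_. 0) = 0\<^sub>m m n"
  by (rule eq_matI) (auto simp: real_diag_def)

lemma real_diag_add: "real_diag m n c + real_diag m n d = real_diag m n (\<lambda>i. c i + d i)"
  by (rule eq_matI) (auto simp: real_diag_def)

text \<open>The guard \<open>i < n\<close> matters when the middle size is the smallest: a later
  diagonal position has no intermediate index to pass through.\<close>

lemma real_diag_mult:
  "real_diag m n c * real_diag n k d = real_diag m k (\<lambda>i. if i < n then c i * d i else 0)"
proof (rule eq_matI)
  fix i j assume "i < dim_row (real_diag m k (\<lambda>i. if i < n then c i * d i else 0) :: 'a mat)"
    "j < dim_col (real_diag m k (\<lambda>i. if i < n then c i * d i else 0) :: 'a mat)"
  then have ij: "i < m" "j < k" by auto
  then have "(real_diag m n c * real_diag n k d) $$ (i, j) =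
      (\<Sum>l\<in>{0..<n}. (if i = l then of_real (c i) else 0) * (if l = j then of_real (d l) else (0 :: 'a)))"
    by (auto simp: real_diag_def scalar_prod_def intro!: sum.cong)
  also have "\<dots> = (\<Sum>l\<in>{0..<n}. if l = i then if i = j then of_real (c i * d i) else 0 else 0)"
    by (intro sum.cong) auto
  finally show "(real_diag m n c * real_diag n k d) $$ (i, j) =
      (real_diag m k (\<lambda>i. if i < n then c i * d i else 0) :: 'a mat) $$ (i, j)"
    using ij by (simp add: real_diag_def)
qed auto

lemma real_diag_Suc:
  "direct_sum (real_smult c (1\<^sub>m 1)) (real_diag m n f) = real_diag (Suc m) (Suc n) (case_nat c f)"
proof (rule eq_matI)
  fix i j assume "i < dim_row (real_diag (Suc m) (Suc n) (case_nat c f) :: 'a mat)"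
    "j < dim_col (real_diag (Suc m) (Suc n) (case_nat c f) :: 'a mat)"
  then show "direct_sum (real_smult c (1\<^sub>m 1)) (real_diag m n f) $$ (i, j) =
      (real_diag (Suc m) (Suc n) (case_nat c f) :: 'a mat) $$ (i, j)"
    by (cases i; cases j) (auto simp: direct_sum_def real_diag_def)
qed (auto simp: direct_sum_def real_diag_def)

section \<open>Invertible matrices and completion of a column to a basis\<close>

lemma general_linear_iff:
  "A \<in> general_linear n \<longleftrightarrow>
     A \<in> carrier_mat n n \<and> (\<exists>B\<in>carrier_mat n n. A * B = 1\<^sub>m n \<and> B * A = 1\<^sub>m n)"
proof
  assume "A \<in> general_linear n"
  then obtain B where A: "A \<in> carrier_mat n n"
    and AB: "A * B = 1\<^sub>m n" and BA: "B * A = 1\<^sub>m (dim_row B)"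
    by (auto simp: general_linear_def invertible_mat_def inverts_mat_def)
  \<comment> \<open>The size of \<open>B\<close> is not given; it is forced by the two unit
    matrices.\<close>
  have "dim_col B = n"
    using arg_cong[OF AB, of dim_col] by simp
  moreover have "dim_row B = n"
    using arg_cong[OF BA, of dim_col] A by simp
  ultimately have "B \<in> carrier_mat n n" "B * A = 1\<^sub>m n"
    using BA by auto
  then show "A \<in> carrier_mat n n \<and> (\<exists>B\<in>carrier_mat n n. A * B = 1\<^sub>m n \<and> B * A = 1\<^sub>m n)"
    using A AB by blast
qed (auto simp: general_linear_def invertible_mat_def inverts_mat_def)

lemma general_linear_inverse:
  assumes "A \<in> general_linear n"
  obtains B where "B \<in> general_linear n" "A * B = 1\<^sub>m n" "B * A = 1\<^sub>m n"
  using assms by (metis general_linear_iff)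

lemma general_linear_carrier: "A \<in> general_linear n \<Longrightarrow> A \<in> carrier_mat n n"
  by (simp add: general_linear_def)

lemma general_linear_one: "1\<^sub>m n \<in> general_linear n"
  unfolding general_linear_iff by (intro conjI bexI[of _ "1\<^sub>m n"]) auto

lemma general_linear_mult:
  assumes "A \<in> general_linear n" "B \<in> general_linear n"
  shows "A * B \<in> general_linear n"
proof -
  obtain A' B' where c: "A \<in> carrier_mat n n" "B \<in> carrier_mat n n"
      "A' \<in> carrier_mat n n" "B' \<in> carrier_mat n n"
    and inv: "A * A' = 1\<^sub>m n" "A' * A = 1\<^sub>m n" "B * B' = 1\<^sub>m n" "B' * B = 1\<^sub>m n"
    using assms by (auto simp: general_linear_iff)
  have "A * B * (B' * A') = A * (B * B') * A'" "B' * A' * (A * B) = B' * (A' * A) * B"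
    using c by (auto simp: mult_mat_assoc)
  then show ?thesis
    unfolding general_linear_iff
    using c by (intro conjI bexI[of _ "B' * A'"]) (simp_all add: inv)
qed

lemma general_linear_direct_sum:
  assumes "A \<in> general_linear m" "B \<in> general_linear n"
  shows "direct_sum A B \<in> general_linear (m + n)"
proof -
  obtain A' B' where "A \<in> carrier_mat m m" "B \<in> carrier_mat n n"
      "A' \<in> carrier_mat m m" "B' \<in> carrier_mat n n"
      "A * A' = 1\<^sub>m m" "A' * A = 1\<^sub>m m" "B * B' = 1\<^sub>m n" "B' * B = 1\<^sub>m n"
    using assms by (auto simp: general_linear_iff)
  then show ?thesis
    unfolding general_linear_iff
    by (intro conjI bexI[of _ "direct_sum A' B'"]) (auto simp: direct_sum_mult direct_sum_one)
qed

lemma general_linear_mult_eq_0: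
  fixes P :: "'a :: ring_1 mat"
  assumes P: "P \<in> general_linear n" and x: "x \<in> carrier_mat n k" and Px: "P * x = 0\<^sub>m n k"
  shows "x = 0\<^sub>m n k"
proof -
  obtain Q where Q: "Q \<in> carrier_mat n n" "Q * P = 1\<^sub>m n"
    using P by (auto simp: general_linear_iff)
  have "x = Q * P * x" using Q x by simp
  also have "\<dots> = Q * (P * x)"
    using Q x general_linear_carrier[OF P] by (intro assoc_mult_mat) auto
  also have "\<dots> = 0\<^sub>m n k" using Px Q by simp
  finally show ?thesis .
qed

text \<open>The first standard basis vector. Vectors are matrices with one column throughout, so
  that products, adjoints and forms stay within one calculus.\<close>

definition first_unit :: "nat \<Rightarrow> 'a :: zero_neq_one mat" where
  "first_unit n = mat n 1 (\<lambda>(i, j). if i = 0 then 1 else 0)"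

lemma first_unit_carrier [simp]:
  "first_unit n \<in> carrier_mat n 1" "first_unit n \<in> carrier_mat n (Suc 0)"
  by (simp_all add: first_unit_def)

lemma dim_first_unit [simp]: "dim_row (first_unit n) = n" "dim_col (first_unit n) = 1"
  by (simp_all add: first_unit_def)

lemma first_unit_neq_0:
  assumes "n > 0"
  shows "first_unit n \<noteq> (0\<^sub>m n 1 :: 'a :: zero_neq_one mat)"
proof
  assume "first_unit n = (0\<^sub>m n 1 :: 'a mat)"
  then have "first_unit n $$ (0, 0) = (0\<^sub>m n 1 :: 'a mat) $$ (0, 0)"
    by (rule arg_cong)
  then show False using assms by (simp add: first_unit_def)
qed

lemma index_mult_first_unit:
  fixes A :: "'a :: ring_1 mat"
  assumes "A \<in> carrier_mat m n" "i < m" "0 < n"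
  shows "(A * first_unit n) $$ (i, 0) = A $$ (i, 0)"
proof -
  have "(A * first_unit n) $$ (i, 0) = (\<Sum>k\<in>{0..<n}. A $$ (i, k) * (if k = 0 then 1 else 0))"
    using assms by (auto simp: scalar_prod_def first_unit_def intro!: sum.cong)
  also have "\<dots> = (\<Sum>k\<in>{0..<n}. if k = 0 then A $$ (i, 0) else 0)"
    by (intro sum.cong) auto
  finally show ?thesis using assms by simp
qed

text \<open>Completes a nonzero column to a basis without dimension theory. A row swap
  \<open>S\<close> brings a nonzero entry to the top; the swapped column \<open>y\<close> is then
  the first column of the lower triangular matrix \<open>L\<close>, whose remaining columns are unit
  vectors.\<close>

lemma general_linear_first_column:
  fixes x :: "'a :: division_ring mat"
  assumes x: "x \<in> carrier_mat (Suc n) 1" and nz: "x \<noteq> 0\<^sub>m (Suc n) 1"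
  shows "\<exists>P\<in>general_linear (Suc n). P * first_unit (Suc n) = x"
proof -
  obtain k where k: "k < Suc n" "x $$ (k, 0) \<noteq> 0"
    using nz x by (metis One_nat_def carrier_matD eq_matI index_zero_mat less_one)
  define S :: "'a mat" where "S = swaprows_mat (Suc n) k 0"
  have S: "S \<in> carrier_mat (Suc n) (Suc n)" "S * S = 1\<^sub>m (Suc n)"
    using k by (simp_all add: S_def swaprows_mat_inv)
  then have S_GL: "S \<in> general_linear (Suc n)"
    unfolding general_linear_iff by blast
  define y where "y = S * x"
  have y: "y \<in> carrier_mat (Suc n) 1" using S x by (simp add: y_def)
  have "y = swaprows k 0 x"
    unfolding y_def S_def using x k by (intro swaprows_mat[symmetric]) auto
  then have y0: "y $$ (0, 0) \<noteq> 0" using x k by auto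
  define a where "a = y $$ (0, 0)"
  define a1 where "a1 = mat 1 1 (\<lambda>_. a)"
  define a2 where "a2 = mat 1 1 (\<lambda>_. inverse a)"
  define r where "r = mat n 1 (\<lambda>(i, j). y $$ (Suc i, 0))"
  have a12: "a1 * a2 = 1\<^sub>m 1" "a2 * a1 = 1\<^sub>m 1"
    using y0 by (auto simp: a1_def a2_def a_def scalar_prod_def intro!: eq_matI)
  have c [simp]: "a1 \<in> carrier_mat 1 1" "a2 \<in> carrier_mat 1 1" "r \<in> carrier_mat n 1"
    by (simp_all add: a1_def a2_def r_def)
  have [simp]: "dim_row a1 = 1" "dim_col a1 = 1" "dim_row a2 = 1" "dim_col a2 = 1"
    "dim_row r = n" "dim_col r = 1"
    by (simp_all add: a1_def a2_def r_def)
  define L where "L = four_block_mat a1 (0\<^sub>m 1 n) r (1\<^sub>m n)"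
  \<comment> \<open>The inverse of \<open>L\<close>, by forward substitution; the factor
    \<open>a2\<close> must stand to the right of \<open>r\<close>.\<close>
  define L' where "L' = four_block_mat a2 (0\<^sub>m 1 n) (- (r * a2)) (1\<^sub>m n)"
  have L: "L \<in> carrier_mat (Suc n) (Suc n)" "L' \<in> carrier_mat (Suc n) (Suc n)"
    using four_block_carrier_mat[OF c(1), of "1\<^sub>m n" n n "0\<^sub>m 1 n" r]
      four_block_carrier_mat[OF c(2), of "1\<^sub>m n" n n "0\<^sub>m 1 n" "- (r * a2)"]
    by (simp_all add: L_def L'_def)
  have ra: "r * a2 * a1 = r"
    unfolding assoc_mult_mat[OF c(3) c(2) c(1)] a12 by (rule right_mult_one_mat[OF c(3)])
  have "L * L' = four_block_mat (1\<^sub>m 1) (0\<^sub>m 1 n) (r * a2 + - (r * a2)) (1\<^sub>m n)"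
    unfolding L_def L'_def
    by (subst mult_four_block_mat[of _ 1 1 _ n _ n _ _ 1 _ n])
      (auto simp: a12 intro!: cong_four_block_mat)
  also have "r * a2 + - (r * a2) = 0\<^sub>m n 1"
    by (rule eq_matI) auto
  finally have LL': "L * L' = 1\<^sub>m (Suc n)" by simp
  have "L' * L = four_block_mat (1\<^sub>m 1) (0\<^sub>m 1 n) (- (r * a2) * a1 + r) (1\<^sub>m n)"
    unfolding L_def L'_def
    by (subst mult_four_block_mat[of _ 1 1 _ n _ n _ _ 1 _ n])
      (auto simp: a12 intro!: cong_four_block_mat)
  also have "- (r * a2) * a1 + r = 0\<^sub>m n 1"
    using ra by (auto simp: uminus_mult_left_mat intro!: eq_matI)
  finally have L'L: "L' * L = 1\<^sub>m (Suc n)" by simp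
  have L_GL: "L \<in> general_linear (Suc n)"
    unfolding general_linear_iff using L LL' L'L by blast
  have Ly: "L * first_unit (Suc n) = y"
  proof (rule eq_matI)
    fix i j assume ij: "i < dim_row y" "j < dim_col y"
    then have [simp]: "j = 0" and i: "i < Suc n" using y by auto
    have "L $$ (i, 0) = y $$ (i, 0)"
      using i by (cases i) (auto simp: L_def a1_def a_def r_def)
    then show "(L * first_unit (Suc n)) $$ (i, j) = y $$ (i, j)"
      using index_mult_first_unit[OF L(1) i] by simp
  qed (use L y in auto)
  have "S * L * first_unit (Suc n) = S * (L * first_unit (Suc n))"
    using S L by (intro assoc_mult_mat) auto
  also have "\<dots> = S * S * x"
    unfolding Ly unfolding y_def using S x by (intro assoc_mult_mat[symmetric]) auto
  also have "\<dots> = x" using S x by simp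
  finally show ?thesis using general_linear_mult[OF S_GL L_GL] by blast
qed

section \<open>Hermitian forms\<close>

text \<open>Keeping only the real part gives a real-bilinear form whether or not scalars commute.
  For a Hermitian matrix and \<open>x = y\<close> nothing is lost, by
  \<open>hermitian_value\<close>.\<close>

definition sesq :: "'a :: star_division mat \<Rightarrow> 'a mat \<Rightarrow> 'a mat \<Rightarrow> real" where
  "sesq Z x y = real_part ((conj_transpose x * (Z * y)) $$ (0, 0))"

lemma sesq_congruence:
  assumes "Z \<in> carrier_mat m n" "P \<in> carrier_mat m k" "Q \<in> carrier_mat n l"
    "x \<in> carrier_mat k 1" "y \<in> carrier_mat l 1"
  shows "sesq Z (P * x) (Q * y) = sesq (conj_transpose P * Z * Q) x y"
proof -
  have "conj_transpose (P * x) * (Z * (Q * y)) = conj_transpose x * (conj_transpose P * Z * Q * y)"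
    using assms by (simp add: conj_transpose_mult mult_mat_assoc)
  then show ?thesis by (simp add: sesq_def)
qed

lemma sesq_add_left:
  assumes "Z \<in> carrier_mat m n" "x \<in> carrier_mat m 1" "y \<in> carrier_mat m 1" "z \<in> carrier_mat n 1"
  shows "sesq Z (x + y) z = sesq Z x z + sesq Z y z"
proof -
  have "conj_transpose (x + y) = conj_transpose x + conj_transpose y"
    using assms by (intro eq_matI) (auto simp: conjugate_add)
  then have "conj_transpose (x + y) * (Z * z) = conj_transpose x * (Z * z) + conj_transpose y * (Z * z)"
    using assms by (simp add: add_mult_distrib_mat[of _ 1 m _ _ 1])
  then show ?thesis
    using assms by (simp add: sesq_def real_part_add)
qed

lemma sesq_add_right:
  assumes "Z \<in> carrier_mat m n" "x \<in> carrier_mat n 1" "y \<in> carrier_mat n 1" "z \<in> carrier_mat m 1"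
  shows "sesq Z z (x + y) = sesq Z z x + sesq Z z y"
proof -
  have "conj_transpose z * (Z * (x + y)) = conj_transpose z * (Z * x) + conj_transpose z * (Z * y)"
    using assms by (simp add: mult_add_distrib_mat[of _ m n _ 1] mult_add_distrib_mat[of _ 1 m _ 1])
  then show ?thesis
    using assms by (simp add: sesq_def real_part_add)
qed

lemma sesq_real_smult_left:
  assumes "Z \<in> carrier_mat m n" "x \<in> carrier_mat m 1" "y \<in> carrier_mat n 1"
  shows "sesq Z (real_smult r x) y = r * sesq Z x y"
  using assms
  by (simp add: sesq_def conj_transpose_real_smult real_smult_mult_left real_part_of_real_mult)

lemma sesq_real_smult_right:
  assumes "Z \<in> carrier_mat m n" "x \<in> carrier_mat m 1" "y \<in> carrier_mat n 1"
  shows "sesq Z x (real_smult r y) = r * sesq Z x y"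
  using assms
  by (simp add: sesq_def real_smult_mult_right real_part_of_real_mult)

lemma sesq_real_smult_mat:
  assumes "Z \<in> carrier_mat m n" "x \<in> carrier_mat m 1" "y \<in> carrier_mat n 1"
  shows "sesq (real_smult r Z) x y = r * sesq Z x y"
  using assms
  by (simp add: sesq_def real_smult_mult_left real_smult_mult_right real_part_of_real_mult)

lemma sesq_diff_mat:
  assumes "Z \<in> carrier_mat m n" "W \<in> carrier_mat m n" "x \<in> carrier_mat m 1" "y \<in> carrier_mat n 1"
  shows "sesq (Z - W) x y = sesq Z x y - sesq W x y"
proof -
  have "conj_transpose x * ((Z - W) * y) = conj_transpose x * (Z * y) - conj_transpose x * (W * y)"
    using assms
    by (simp add: minus_mult_distrib_mat[of _ m n _ _ 1] mult_minus_distrib_mat[of _ 1 m _ 1])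
  then show ?thesis
    using assms by (simp add: sesq_def real_part_diff)
qed

lemma sesq_conj_transpose:
  assumes "Z \<in> carrier_mat m n" "x \<in> carrier_mat m 1" "y \<in> carrier_mat n 1"
  shows "sesq (conj_transpose Z) y x = sesq Z x y"
proof -
  have "conj_transpose y * (conj_transpose Z * x) = conj_transpose (conj_transpose x * (Z * y))"
    using assms by (simp add: conj_transpose_mult mult_mat_assoc)
  then show ?thesis
    using assms by (simp add: sesq_def real_part_conjugate)
qed

lemma sesq_one_eq_sum:
  assumes "x \<in> carrier_mat n 1"
  shows "sesq (1\<^sub>m n) x x = (\<Sum>i<n. sq_abs (x $$ (i, 0)))"
  using assms
  by (simp add: sesq_def scalar_prod_def real_part_sum sq_abs_def lessThan_atLeast0)

lemma sesq_eq_sum: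
  assumes "Z \<in> carrier_mat n n" "x \<in> carrier_mat n 1"
  shows "sesq Z x x = (\<Sum>i<n. \<Sum>j<n. real_part (conjugate (x $$ (i, 0)) * (Z $$ (i, j) * x $$ (j, 0))))"
  using assms
  by (simp add: sesq_def scalar_prod_def real_part_sum sum_distrib_left lessThan_atLeast0)

lemma sesq_one_nonneg: "x \<in> carrier_mat n 1 \<Longrightarrow> sesq (1\<^sub>m n) x x \<ge> 0"
  by (simp add: sesq_one_eq_sum sum_nonneg)

lemma sesq_one_eq_0:
  assumes "x \<in> carrier_mat n 1" "sesq (1\<^sub>m n) x x \<le> 0"
  shows "x = 0\<^sub>m n 1"
proof -
  have "sesq (1\<^sub>m n) x x = 0"
    using assms sesq_one_nonneg[OF assms(1)] by simp
  then have "\<forall>i<n. sq_abs (x $$ (i, 0)) = 0"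
    using assms(1) by (simp add: sesq_one_eq_sum sum_nonneg_eq_0_iff)
  then show ?thesis
    using assms(1) by (intro eq_matI) auto
qed

lemma sesq_mult_self:
  assumes "A \<in> carrier_mat m n" "x \<in> carrier_mat n 1" "y \<in> carrier_mat n 1"
  shows "sesq (conj_transpose A * A) x y = sesq (1\<^sub>m m) (A * x) (A * y)"
  using sesq_congruence[of "1\<^sub>m m" m m A n A n x y] assms by simp

section \<open>Positive definite matrices and orthonormal bases\<close>

definition pos_def :: "nat \<Rightarrow> 'a :: star_division mat \<Rightarrow> bool" where
  "pos_def n A \<longleftrightarrow> A \<in> carrier_mat n n \<and> conj_transpose A = A \<and>
     (\<forall>x\<in>carrier_mat n 1. x \<noteq> 0\<^sub>m n 1 \<longrightarrow> sesq A x x > 0)"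

lemma pos_def_one: "pos_def n (1\<^sub>m n)"
  unfolding pos_def_def by (metis sesq_one_eq_0 not_le conj_transpose_one one_carrier_mat)

lemma pos_def_carrier: "pos_def n A \<Longrightarrow> A \<in> carrier_mat n n"
  by (simp add: pos_def_def)

lemma pos_def_congruence:
  assumes A: "pos_def n A" and P: "P \<in> general_linear n"
  shows "pos_def n (conj_transpose P * A * P)"
  unfolding pos_def_def
proof (intro conjI ballI impI)
  have c: "A \<in> carrier_mat n n" "P \<in> carrier_mat n n"
    using assms by (auto simp: pos_def_carrier general_linear_carrier)
  then show "conj_transpose P * A * P \<in> carrier_mat n n" by simp
  show "conj_transpose (conj_transpose P * A * P) = conj_transpose P * A * P"
    using c A by (simp add: conj_transpose_mult mult_mat_assoc pos_def_def)
  fix x :: "'a mat" assume x: "x \<in> carrier_mat n 1" "x \<noteq> 0\<^sub>m n 1"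
  then have "P * x \<noteq> 0\<^sub>m n 1"
    using general_linear_mult_eq_0[OF P] by blast
  moreover have "P * x \<in> carrier_mat n 1" using c x by simp
  ultimately have "sesq A (P * x) (P * x) > 0"
    using A by (simp add: pos_def_def)
  then show "sesq (conj_transpose P * A * P) x x > 0"
    by (simp only: sesq_congruence[OF c(1) c(2) c(2) x(1) x(1)])
qed

lemma hermitian_value:
  assumes A: "A \<in> carrier_mat n n" "conj_transpose A = A" and x: "x \<in> carrier_mat n 1"
  shows "conj_transpose x * A * x = real_smult (sesq A x x) (1\<^sub>m 1)"
proof -
  define Z where "Z = conj_transpose x * A * x"
  have Z: "Z \<in> carrier_mat 1 1" using A x by (simp add: Z_def)
  have "conj_transpose Z = Z"
    using A x by (simp add: Z_def conj_transpose_mult mult_mat_assoc)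
  then have "conjugate (Z $$ (0, 0)) = Z $$ (0, 0)"
    using Z index_conj_transpose[of 0 Z 0] by simp
  then have "of_real (real_part (Z $$ (0, 0))) = Z $$ (0, 0)"
    by (rule of_real_real_part)
  moreover have "sesq A x x = real_part (Z $$ (0, 0))"
    using A x by (simp add: sesq_def Z_def mult_mat_assoc)
  ultimately show ?thesis
    unfolding Z_def[symmetric] using Z by (intro eq_matI) auto
qed

lemma pos_def_normalize:
  assumes A: "pos_def n A" and x: "x \<in> carrier_mat n 1" "x \<noteq> 0\<^sub>m n 1"
  shows "\<exists>r>0. sesq A (real_smult r x) (real_smult r x) = 1"
proof -
  have pos: "sesq A x x > 0" using assms by (simp add: pos_def_def)
  define r where "r = 1 / sqrt (sesq A x x)"
  have "r * r * sesq A x x = 1"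
    using pos by (simp add: r_def)
  then have "sesq A (real_smult r x) (real_smult r x) = 1"
    using x pos_def_carrier[OF A] by (simp add: sesq_real_smult_left sesq_real_smult_right)
  moreover have "r > 0" using pos by (simp add: r_def)
  ultimately show ?thesis by blast
qed

lemma pos_def_direct_sum_one:
  assumes "pos_def (Suc n) (direct_sum (1\<^sub>m 1) A)" and A: "A \<in> carrier_mat n n"
  shows "pos_def n A"
  unfolding pos_def_def
proof (intro conjI ballI impI)
  have "direct_sum (1\<^sub>m 1) (conj_transpose A) = direct_sum (1\<^sub>m 1) A"
    using assms(1) by (simp add: pos_def_def conj_transpose_direct_sum)
  then have eq: "direct_sum (1\<^sub>m 1) (conj_transpose A) $$ (Suc i, Suc j) = direct_sum (1\<^sub>m 1) A $$ (Suc i, Suc j)"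
    for i j by simp
  show "conj_transpose A = A"
  proof (rule eq_matI)
    fix i j assume "i < dim_row A" "j < dim_col A"
    then show "conj_transpose A $$ (i, j) = A $$ (i, j)"
      using A eq[of i j] by (simp add: direct_sum_def)
  qed (use A in auto)
  fix x :: "'a mat" assume x: "x \<in> carrier_mat n 1" "x \<noteq> 0\<^sub>m n 1"
  define z where "z = direct_sum (0\<^sub>m 1 0) x"
  have z: "z \<in> carrier_mat (Suc n) 1"
    using direct_sum_carrier[of "0\<^sub>m 1 0" 1 0 x n 1] x by (simp add: z_def)
  have "z \<noteq> 0\<^sub>m (Suc n) 1"
  proof
    assume "z = 0\<^sub>m (Suc n) 1"
    then have "z $$ (Suc i, 0) = 0" if "i < n" for i using that by simp
    then have "x $$ (i, 0) = 0" if "i < n" for i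
      using that x by (simp add: z_def direct_sum_def)
    then show False using x by (metis One_nat_def carrier_matD eq_matI index_zero_mat less_one)
  qed
  then have "sesq (direct_sum (1\<^sub>m 1) A) z z > 0"
    using assms(1) z by (simp add: pos_def_def)
  also have "sesq (direct_sum (1\<^sub>m 1) A) z z = sesq A x x"
    using A x by (simp add: sesq_def z_def conj_transpose_direct_sum direct_sum_mult)
      (simp add: direct_sum_empty_left)
  finally show "sesq A x x > 0" .
qed (rule A)

text \<open>One step of Lagrange's diagonalisation: the first column is completed to a basis, and
  the remaining basis vectors are made orthogonal to it.\<close>

lemma pos_def_deflation:
  assumes A: "pos_def (Suc n) A" and x: "x \<in> carrier_mat (Suc n) 1" and one: "sesq A x x = 1"
  shows "\<exists>P\<in>general_linear (Suc n). \<exists>A'. P * first_unit (Suc n) = x \<and> pos_def n A' \<and>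
    conj_transpose P * A * P = direct_sum (1\<^sub>m 1) A'"
proof -
  have cA: "A \<in> carrier_mat (Suc n) (Suc n)" and hA: "conj_transpose A = A"
    using A by (auto simp: pos_def_def)
  have "x \<noteq> 0\<^sub>m (Suc n) 1"
    using one cA by (auto simp: sesq_def)
  then obtain P0 where P0: "P0 \<in> general_linear (Suc n)" "P0 * first_unit (Suc n) = x"
    using general_linear_first_column[OF x] by blast
  then have cP0: "P0 \<in> carrier_mat (Suc n) (Suc n)" by (simp add: general_linear_carrier)
  define A0 where "A0 = conj_transpose P0 * A * P0"
  have pA0: "pos_def (Suc n) A0" unfolding A0_def by (rule pos_def_congruence[OF A P0(1)])
  then have cA0: "A0 \<in> carrier_mat (Suc n) (Suc n)" and hA0: "conj_transpose A0 = A0"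
    by (auto simp: pos_def_def)
  define b where "b = mat 1 n (\<lambda>(i, j). A0 $$ (0, Suc j))"
  define d where "d = mat n n (\<lambda>(i, j). A0 $$ (Suc i, Suc j))"
  have c [simp]: "b \<in> carrier_mat 1 n" "d \<in> carrier_mat n n"
    by (simp_all add: b_def d_def)
  have dims [simp]: "dim_row b = 1" "dim_col b = n" "dim_row d = n" "dim_col d = n"
    by (simp_all add: b_def d_def)
  have "conj_transpose (first_unit (Suc n)) * (A0 * first_unit (Suc n)) = conj_transpose x * A * x"
    using cA cP0 by (simp add: A0_def P0(2)[symmetric] conj_transpose_mult mult_mat_assoc)
  also have "\<dots> = 1\<^sub>m 1"
    using hermitian_value[OF cA hA x] one by simp
  finally have "(conj_transpose (first_unit (Suc n)) * (A0 * first_unit (Suc n))) $$ (0, 0) = 1"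
    by simp
  moreover have "(conj_transpose (first_unit (Suc n)) * (A0 * first_unit (Suc n))) $$ (0, 0) = A0 $$ (0, 0)"
  proof -
    \<comment> \<open>\<open>index_mult_first_unit\<close> reads off columns only, so the row index
      is reached by passing to the adjoint.\<close>
    have "conj_transpose (first_unit (Suc n)) * (A0 * first_unit (Suc n)) =
        conj_transpose (A0 * first_unit (Suc n)) * first_unit (Suc n)"
      using cA0 hA0 by (simp add: conj_transpose_mult mult_mat_assoc)
    then have "(conj_transpose (first_unit (Suc n)) * (A0 * first_unit (Suc n))) $$ (0, 0) =
        conj_transpose (A0 * first_unit (Suc n)) $$ (0, 0)"
      using cA0 index_mult_first_unit[of "conj_transpose (A0 * first_unit (Suc n))" 1 "Suc n" 0]
      by simp
    also have "\<dots> = conjugate ((A0 * first_unit (Suc n)) $$ (0, 0))"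
      using cA0 by (simp del: index_mult_mat(1))
    also have "\<dots> = conjugate (A0 $$ (0, 0))"
      using cA0 by (simp add: index_mult_first_unit[of _ "Suc n" "Suc n"] del: index_mult_mat(1))
    also have "\<dots> = A0 $$ (0, 0)"
      using arg_cong[OF hA0, of "\<lambda>M. M $$ (0, 0)"] cA0 by simp
    finally show ?thesis .
  qed
  ultimately have A00: "A0 $$ (0, 0) = 1" by simp
  have A0_block: "A0 = four_block_mat (1\<^sub>m 1) b (conj_transpose b) d"
  proof (rule eq_matI)
    fix i j assume "i < dim_row (four_block_mat (1\<^sub>m 1) b (conj_transpose b) d)"
      "j < dim_col (four_block_mat (1\<^sub>m 1) b (conj_transpose b) d)"
    then have ij: "i < Suc n" "j < Suc n" by auto
    show "A0 $$ (i, j) = four_block_mat (1\<^sub>m 1) b (conj_transpose b) d $$ (i, j)"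
    proof (cases i)
      case (Suc i')
      have "conjugate (A0 $$ (0, i)) = A0 $$ (i, 0)"
        using arg_cong[OF hA0, of "\<lambda>M. M $$ (i, 0)"] cA0 ij by simp
      then show ?thesis
        using Suc ij by (cases j) (auto simp: b_def d_def)
    qed (use ij A00 in \<open>cases j; auto simp: b_def\<close>)
  qed (use cA0 in auto)
  \<comment> \<open>Subtracts from each later basis vector its component along the first one; the
    row \<open>b\<close> holds the inner products of the first vector with the later ones.\<close>
  define P1 where "P1 = four_block_mat (1\<^sub>m 1) (- b) (0\<^sub>m n 1) (1\<^sub>m n)"
  define P1' where "P1' = four_block_mat (1\<^sub>m 1) b (0\<^sub>m n 1) (1\<^sub>m n)"
  have cP1: "P1 \<in> carrier_mat (Suc n) (Suc n)" "P1' \<in> carrier_mat (Suc n) (Suc n)"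
    by (auto simp: P1_def P1'_def intro!: carrier_matI)
  have "P1 * P1' = 1\<^sub>m (Suc n)" "P1' * P1 = 1\<^sub>m (Suc n)"
    unfolding P1_def P1'_def
    by (subst mult_four_block_mat[of _ 1 1 _ n _ n _ _ 1 _ n]; auto intro!: eq_matI)+
  then have P1: "P1 \<in> general_linear (Suc n)"
    unfolding general_linear_iff using cP1 by blast
  have P1_first: "P1 * first_unit (Suc n) = first_unit (Suc n)"
  proof (rule eq_matI)
    fix i j assume "i < dim_row (first_unit (Suc n) :: 'a mat)" "j < dim_col (first_unit (Suc n) :: 'a mat)"
    then have ij: "i < Suc n" "j = 0" by auto
    have "P1 $$ (i, 0) = (if i = 0 then 1 else 0)"
      using ij by (simp add: P1_def)
    then show "(P1 * first_unit (Suc n)) $$ (i, j) = first_unit (Suc n) $$ (i, j)"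
      using ij index_mult_first_unit[OF cP1(1), of i] by (simp add: first_unit_def)
  qed (use cP1 in auto)
  \<comment> \<open>The Schur complement of the corner entry 1.\<close>
  define A' where "A' = d - conj_transpose b * b"
  have cA': "A' \<in> carrier_mat n n" by (auto simp: A'_def intro!: carrier_matI)
  have "conj_transpose P1 = four_block_mat (1\<^sub>m 1) (0\<^sub>m 1 n) (- conj_transpose b) (1\<^sub>m n)"
    by (rule eq_matI) (auto simp: P1_def conjugate_minus)
  then have "conj_transpose P1 * A0 = four_block_mat (1\<^sub>m 1) b (0\<^sub>m n 1) (d - conj_transpose b * b)"
    unfolding A0_block
    by (simp, subst mult_four_block_mat[of _ 1 1 _ n _ n _ _ 1 _ n]; auto intro!: eq_matI)
  then have "conj_transpose P1 * A0 * P1 = direct_sum (1\<^sub>m 1) A'"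
    unfolding P1_def direct_sum_def A'_def
    by (simp, subst mult_four_block_mat[of _ 1 1 _ n _ n _ _ 1 _ n]; auto intro!: eq_matI)
  moreover have "conj_transpose (P0 * P1) * A * (P0 * P1) = conj_transpose P1 * A0 * P1"
    using cA cP0 cP1 by (simp add: A0_def conj_transpose_mult mult_mat_assoc)
  ultimately have eq: "conj_transpose (P0 * P1) * A * (P0 * P1) = direct_sum (1\<^sub>m 1) A'"
    by simp
  have GL: "P0 * P1 \<in> general_linear (Suc n)" by (rule general_linear_mult[OF P0(1) P1])
  have "pos_def n A'"
    using pos_def_direct_sum_one[OF _ cA'] pos_def_congruence[OF A GL] eq by simp
  moreover have "P0 * P1 * first_unit (Suc n) = x"
    using cP0 cP1 P1_first P0(2) by (simp add: mult_mat_assoc)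
  ultimately show ?thesis using eq GL by blast
qed

text \<open>Gram-Schmidt: split off one normalised vector with \<open>pos_def_deflation\<close> and
  recurse on the remaining form. The columns of \<open>P\<close> are an orthonormal basis for
  \<open>A\<close>.\<close>

lemma cholesky:
  assumes "pos_def n A"
  shows "\<exists>P\<in>general_linear n. conj_transpose P * A * P = 1\<^sub>m n"
  using assms
proof (induction n arbitrary: A)
  case 0
  have "conj_transpose (1\<^sub>m 0) * A * 1\<^sub>m 0 = 1\<^sub>m 0"
    by (rule eq_matI) auto
  then show ?case using general_linear_one by blast
next
  case (Suc n)
  obtain r where "sesq A (real_smult r (first_unit (Suc n))) (real_smult r (first_unit (Suc n))) = 1"
    using pos_def_normalize[OF Suc.prems first_unit_carrier(1) first_unit_neq_0] by blast
  then obtain P A' where P: "P \<in> general_linear (Suc n)" and A': "pos_def n A'"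
    and eq: "conj_transpose P * A * P = direct_sum (1\<^sub>m 1) A'"
    using pos_def_deflation[OF Suc.prems] by (metis real_smult_carrier first_unit_carrier(1))
  obtain Q where Q: "Q \<in> general_linear n" "conj_transpose Q * A' * Q = 1\<^sub>m n"
    using Suc.IH[OF A'] by blast
  define R where "R = direct_sum (1\<^sub>m 1) Q"
  have R: "R \<in> general_linear (Suc n)"
    using general_linear_direct_sum[OF general_linear_one Q(1), of 1] by (simp add: R_def)
  note c = general_linear_carrier[OF P] general_linear_carrier[OF R] pos_def_carrier[OF Suc.prems]
    general_linear_carrier[OF Q(1)] pos_def_carrier[OF A']
  have "conj_transpose (P * R) * A * (P * R) = conj_transpose R * (conj_transpose P * A * P) * R"
    using c by (simp add: conj_transpose_mult mult_mat_assoc)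
  also have "\<dots> = direct_sum (1\<^sub>m 1) (conj_transpose Q * A' * Q)"
    unfolding eq R_def using c by (simp add: conj_transpose_direct_sum direct_sum_mult)
  also have "\<dots> = 1\<^sub>m (Suc n)"
    by (simp add: Q direct_sum_one)
  finally show ?case using general_linear_mult[OF P R] by blast
qed

section \<open>Bounds between forms and the largest eigenvalue\<close>

lemma sesq_bounded:
  assumes T: "T \<in> carrier_mat n n"
  shows "\<exists>C. \<forall>x\<in>carrier_mat n 1. sesq T x x \<le> C * sesq (1\<^sub>m n) x x"
proof (intro exI ballI)
  fix x :: "'a mat" assume x: "x \<in> carrier_mat n 1"
  define s where "s = (\<Sum>i<n. sq_abs (x $$ (i, 0)))"
  have le_s: "sq_abs (x $$ (i, 0)) \<le> s" if "i < n" for i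
    unfolding s_def using that by (intro member_le_sum) auto
  \<comment> \<open>Each of the finitely many terms is bounded separately by
    \<open>two_real_part_mult_le\<close>; a crude constant is enough, since only its existence is
    used.\<close>
  have "real_part (conjugate (x $$ (i, 0)) * (T $$ (i, j) * x $$ (j, 0)))
      \<le> (1 + sq_abs (T $$ (i, j))) / 2 * s" if "i < n" "j < n" for i j
  proof -
    have "2 * real_part (conjugate (x $$ (i, 0)) * (T $$ (i, j) * x $$ (j, 0)))
        \<le> sq_abs (x $$ (i, 0)) + sq_abs (T $$ (i, j)) * sq_abs (x $$ (j, 0))"
      using two_real_part_mult_le[of "x $$ (i, 0)" "T $$ (i, j) * x $$ (j, 0)"]
      by (simp add: sq_abs_mult)
    also have "\<dots> \<le> s + sq_abs (T $$ (i, j)) * s"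
      using le_s that by (intro add_mono mult_left_mono) auto
    finally show ?thesis by (simp add: algebra_simps)
  qed
  then have "sesq T x x \<le> (\<Sum>i<n. \<Sum>j<n. (1 + sq_abs (T $$ (i, j))) / 2 * s)"
    unfolding sesq_eq_sum[OF T x] by (intro sum_mono) auto
  also have "\<dots> = (\<Sum>i<n. \<Sum>j<n. (1 + sq_abs (T $$ (i, j))) / 2) * s"
    by (simp add: sum_distrib_right)
  finally show "sesq T x x \<le> (\<Sum>i<n. \<Sum>j<n. (1 + sq_abs (T $$ (i, j))) / 2) * sesq (1\<^sub>m n) x x"
    by (simp only: sesq_one_eq_sum[OF x] s_def)
qed

text \<open>In the coordinates of an orthonormal basis for \<open>M\<close>, provided by
  \<open>cholesky\<close>, this is \<open>sesq_bounded\<close>.\<close>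

lemma sesq_bounded_pos_def:
  assumes M: "pos_def n M" and T: "T \<in> carrier_mat n n"
  shows "\<exists>C>0. \<forall>x\<in>carrier_mat n 1. sesq T x x \<le> C * sesq M x x"
proof -
  obtain P where P: "P \<in> general_linear n" "conj_transpose P * M * P = 1\<^sub>m n"
    using cholesky[OF M] by blast
  then obtain Q where Q: "Q \<in> carrier_mat n n" "P * Q = 1\<^sub>m n"
    by (auto simp: general_linear_iff)
  note c = general_linear_carrier[OF P(1)] pos_def_carrier[OF M]
  have "conj_transpose P * T * P \<in> carrier_mat n n" using c T by simp
  then obtain C where C: "\<forall>x\<in>carrier_mat n 1.
      sesq (conj_transpose P * T * P) x x \<le> C * sesq (1\<^sub>m n) x x"
    using sesq_bounded by blast
  \<comment> \<open>The constant is raised to at least 1 to make it positive: later it is divided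
    by.\<close>
  have "sesq T x x \<le> max C 1 * sesq M x x" if x: "x \<in> carrier_mat n 1" for x
  proof -
    have Qx: "Q * x \<in> carrier_mat n 1" using Q x by simp
    have "P * (Q * x) = P * Q * x"
      using c Q x by (intro assoc_mult_mat[symmetric]) auto
    then have PQx: "P * (Q * x) = x" using Q x by simp
    have "sesq T x x = sesq (conj_transpose P * T * P) (Q * x) (Q * x)"
      using sesq_congruence[OF T c(1) c(1) Qx Qx] by (simp only: PQx)
    also have "\<dots> \<le> C * sesq (1\<^sub>m n) (Q * x) (Q * x)" using C Qx by blast
    also have "\<dots> \<le> max C 1 * sesq (1\<^sub>m n) (Q * x) (Q * x)"
      using sesq_one_nonneg[OF Qx] by (intro mult_right_mono) auto
    also have "sesq (1\<^sub>m n) (Q * x) (Q * x) = sesq M x x"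
      using sesq_congruence[OF c(2) c(1) c(1) Qx Qx] by (simp only: PQx P(2))
    finally show ?thesis .
  qed
  moreover have "max C 1 > 0" by simp
  ultimately show ?thesis by blast
qed

text \<open>If \<open>y = Z * x\<close> were nonzero, a short move from \<open>x\<close> in the
  direction of \<open>- y\<close> would make the form negative: its first-order change is minus
  twice the squared length of \<open>y\<close> times the step.\<close>

lemma semidefinite_kernel:
  assumes Z: "Z \<in> carrier_mat n n" "conj_transpose Z = Z"
    and nonneg: "\<And>x. x \<in> carrier_mat n 1 \<Longrightarrow> sesq Z x x \<ge> 0"
    and x: "x \<in> carrier_mat n 1" "sesq Z x x \<le> 0"
  shows "Z * x = 0\<^sub>m n 1"
proof -
  define y where "y = Z * x"
  have y: "y \<in> carrier_mat n 1" using Z x by (simp add: y_def)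
  have yx: "sesq Z y x = sesq (1\<^sub>m n) y y"
    using y by (simp add: sesq_def y_def[symmetric])
  have xy: "sesq Z x y = sesq (1\<^sub>m n) y y"
    using sesq_conj_transpose[OF Z(1) y x(1)] Z(2) yx by simp
  have small: "2 * sesq (1\<^sub>m n) y y \<le> t * sesq Z y y" if "t > 0" for t
  proof -
    define w where "w = real_smult (- t) y"
    have w: "w \<in> carrier_mat n 1" using y by (simp add: w_def)
    have "0 \<le> sesq Z (x + w) (x + w)" using w x by (intro nonneg) auto
    also have "\<dots> = sesq Z x x - 2 * t * sesq (1\<^sub>m n) y y + t * t * sesq Z y y"
      using Z x(1) y w xy yx
      by (simp add: sesq_add_left[of _ n n] sesq_add_right[of _ n n])
        (simp add: w_def sesq_real_smult_left[of _ n n] sesq_real_smult_right[of _ n n])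
    finally have "t * (2 * sesq (1\<^sub>m n) y y) \<le> t * (t * sesq Z y y)"
      using x(2) by (simp add: algebra_simps)
    then show ?thesis using that by simp
  qed
  have "sesq (1\<^sub>m n) y y \<le> 0"
  proof (rule ccontr)
    assume "\<not> sesq (1\<^sub>m n) y y \<le> 0"
    then have a: "sesq (1\<^sub>m n) y y > 0" and b: "sesq Z y y \<ge> 0" using nonneg y by auto
    \<comment> \<open>The step is chosen so that \<open>t * sesq Z y y\<close> stays below the
      squared length of \<open>y\<close>, against the factor 2 in \<open>small\<close>; the summand
      1 keeps the denominator positive.\<close>
    define t where "t = sesq (1\<^sub>m n) y y / (1 + sesq Z y y)"
    have "t > 0" using a b by (simp add: t_def)
    have "t * sesq Z y y = sesq (1\<^sub>m n) y y * (sesq Z y y / (1 + sesq Z y y))"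
      by (simp add: t_def)
    also have "\<dots> \<le> sesq (1\<^sub>m n) y y * 1"
      using a b by (intro mult_left_mono) (auto simp: divide_le_eq)
    finally show False using small[OF \<open>t > 0\<close>] a by simp
  qed
  then show ?thesis using sesq_one_eq_0[OF y] by (simp add: y_def)
qed

text \<open>The eigenvalue is the supremum of the generalised Rayleigh quotient. It is attained without
  any compactness argument: otherwise \<open>\<lambda>M - N\<close> would be positive definite, hence bounded below
  by a positive multiple of \<open>M\<close>, and \<open>\<lambda>\<close> could be lowered.\<close>

lemma pencil_max_eigenvalue:
  assumes M: "pos_def n M" and N: "N \<in> carrier_mat n n" "conj_transpose N = N" and n: "n > 0"
  shows "\<exists>l. \<exists>x\<in>carrier_mat n 1. x \<noteq> 0\<^sub>m n 1 \<and> N * x = real_smult l (M * x) \<and>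
    (\<forall>z\<in>carrier_mat n 1. sesq N z z \<le> l * sesq M z z)"
proof -
  note cM = pos_def_carrier[OF M]
  have hM: "conj_transpose M = M" using M by (simp add: pos_def_def)
  define X :: "'a mat set" where "X = carrier_mat n 1 - {0\<^sub>m n 1}"
  have pos: "sesq M x x > 0" if "x \<in> X" for x
    using M that by (auto simp: pos_def_def X_def)
  have zero: "sesq Z (0\<^sub>m n 1) (0\<^sub>m n 1) = 0" if "Z \<in> carrier_mat n n" for Z :: "'a mat"
    using that by (simp add: sesq_def)
  define R where "R = (\<lambda>x. sesq N x x / sesq M x x) ` X"
  have "first_unit n \<in> X"
    using n first_unit_neq_0 by (auto simp: X_def)
  then have ne: "R \<noteq> {}" by (auto simp: R_def)
  obtain C where C: "\<forall>x\<in>carrier_mat n 1. sesq N x x \<le> C * sesq M x x"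
    using sesq_bounded_pos_def[OF M N(1)] by blast
  have "r \<le> C" if r: "r \<in> R" for r
  proof -
    obtain x where x: "x \<in> X" "r = sesq N x x / sesq M x x"
      using r by (auto simp: R_def)
    moreover have "sesq N x x \<le> C * sesq M x x"
      using C x by (auto simp: X_def)
    ultimately show ?thesis
      using pos by (simp add: pos_divide_le_eq)
  qed
  then have bdd: "bdd_above R" by (rule bdd_aboveI)
  define l where "l = Sup R"
  have le: "sesq N z z \<le> l * sesq M z z" if z: "z \<in> carrier_mat n 1" for z
  proof (cases "z \<in> X")
    case True
    then have "sesq N z z / sesq M z z \<le> l"
      unfolding l_def using bdd by (intro cSup_upper) (auto simp: R_def)
    then show ?thesis using pos[OF True] by (simp add: pos_divide_le_eq)
  qed (use z zero N cM in \<open>auto simp: X_def\<close>)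
  define Z where "Z = real_smult l M - N"
  have cZ: "Z \<in> carrier_mat n n" unfolding Z_def by (rule minus_carrier_mat[OF N(1)])
  have hZ: "conj_transpose Z = Z"
  proof -
    have "conj_transpose Z = real_smult l (conj_transpose M) - conj_transpose N"
      using cM N(1) unfolding Z_def
      by (intro eq_matI) (auto simp: conjugate_diff of_real_def conjugate_scaleR)
    then show ?thesis by (simp add: hM N Z_def)
  qed
  have Zz: "sesq Z z z = l * sesq M z z - sesq N z z" if "z \<in> carrier_mat n 1" for z
    using that cM N unfolding Z_def
    by (subst sesq_diff_mat[of _ n n]) (auto simp: sesq_real_smult_mat)
  have "\<not> pos_def n Z"
  proof
    assume "pos_def n Z"
    then obtain D where D: "D > 0" "\<forall>x\<in>carrier_mat n 1. sesq M x x \<le> D * sesq Z x x"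
      using sesq_bounded_pos_def[OF _ cM] by blast
    \<comment> \<open>Bounding \<open>M\<close> by \<open>D\<close> times \<open>l M - N\<close>
      pushes every quotient below \<open>l\<close> by at least \<open>1 / D\<close>.\<close>
    have "r \<le> l - 1 / D" if r: "r \<in> R" for r
    proof -
      obtain x where x: "x \<in> X" "r = sesq N x x / sesq M x x"
        using r by (auto simp: R_def)
      then have "sesq M x x \<le> D * (l * sesq M x x - sesq N x x)"
        using D Zz by (auto simp: X_def)
      then have "sesq M x x / D \<le> l * sesq M x x - sesq N x x"
        using D(1) by (simp add: pos_divide_le_eq mult.commute)
      then have "sesq N x x \<le> (l - 1 / D) * sesq M x x"
        by (simp add: algebra_simps)
      then show ?thesis
        using x pos by (simp add: pos_divide_le_eq)
    qed
    then have "l \<le> l - 1 / D"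
      unfolding l_def using ne by (intro cSup_least) auto
    then show False using D(1) by simp
  qed
  \<comment> \<open>\<open>Z\<close> is Hermitian, so failure of definiteness yields a nonzero
    vector with form value at most 0. By \<open>le\<close> the form is semidefinite, so this vector
    lies in the kernel of \<open>Z\<close>, which is the eigenvector equation.\<close>
  then obtain x where x: "x \<in> carrier_mat n 1" "x \<noteq> 0\<^sub>m n 1" "sesq Z x x \<le> 0"
    using cZ hZ by (auto simp: pos_def_def not_less)
  have "Z * x = 0\<^sub>m n 1"
    using cZ hZ x le Zz by (intro semidefinite_kernel[of Z n x]) auto
  then have "real_smult l (M * x) - N * x = 0\<^sub>m n 1"
    using cM N x unfolding Z_def
    by (simp add: minus_mult_distrib_mat[of _ n n _ _ 1] real_smult_mult_left)
  then have eq0: "(real_smult l (M * x) - N * x) $$ (i, 0) = 0" if "i < n" for i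
    using that by simp
  have "N * x = real_smult l (M * x)"
  proof (rule eq_matI)
    fix i j assume ij: "i < dim_row (real_smult l (M * x))" "j < dim_col (real_smult l (M * x))"
    then show "(N * x) $$ (i, j) = real_smult l (M * x) $$ (i, j)"
      using eq0[of i] cM N x by (simp del: index_mult_mat(1))
  qed (use cM N x in auto)
  then show ?thesis using x le by blast
qed

section \<open>Principal vectors\<close>

lemma direct_sum_zero_column_eq_0:
  assumes "x \<in> carrier_mat n 1" "direct_sum (0\<^sub>m 1 0) x = 0\<^sub>m (Suc n) 1"
  shows "x = 0\<^sub>m n 1"
proof (rule eq_matI)
  fix i j assume "i < dim_row (0\<^sub>m n 1 :: 'a mat)" "j < dim_col (0\<^sub>m n 1 :: 'a mat)"
  then have ij: "i < n" "j = 0" by auto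
  have "direct_sum (0\<^sub>m 1 0) x $$ (Suc i, 0) = 0"
    unfolding assms(2) using ij by simp
  then show "x $$ (i, j) = 0\<^sub>m n 1 $$ (i, j)"
    using ij assms(1) by (simp add: direct_sum_def)
qed (use assms in auto)

lemma direct_sum_zero_column_carrier:
  "x \<in> carrier_mat n 1 \<Longrightarrow> direct_sum (0\<^sub>m 1 0) x \<in> carrier_mat (Suc n) 1"
  using direct_sum_carrier[of "0\<^sub>m 1 0" 1 0 x n 1] by simp

lemma sesq_direct_sum_zero_column:
  assumes "A \<in> carrier_mat 1 1" "B \<in> carrier_mat m n" "x \<in> carrier_mat m 1" "y \<in> carrier_mat n 1"
  shows "sesq (direct_sum A B) (direct_sum (0\<^sub>m 1 0) x) (direct_sum (0\<^sub>m 1 0) y) = sesq B x y"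
  using assms
  by (simp add: sesq_def conj_transpose_direct_sum direct_sum_mult) (simp add: direct_sum_empty_left)

text \<open>The assumption \<open>col\<close> prescribes the first column and \<open>row\<close>,
  through the adjoint, the first row; what is left over is the block \<open>B\<close>.\<close>

lemma direct_sum_if_first_unit:
  fixes M :: "'a :: star_division mat"
  assumes M: "M \<in> carrier_mat (Suc m) (Suc n)"
    and col: "M * first_unit (Suc n) = real_smult c (first_unit (Suc m))"
    and row: "conj_transpose M * first_unit (Suc m) = real_smult c (first_unit (Suc n))"
  shows "\<exists>B\<in>carrier_mat m n. M = direct_sum (real_smult c (1\<^sub>m 1)) B"
proof -
  define B where "B = mat m n (\<lambda>(i, j). M $$ (Suc i, Suc j))"
  have c: "M $$ (i, 0) = (if i = 0 then of_real c else 0)" if "i < Suc m" for i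
    using index_mult_first_unit[OF M that] that unfolding col
    by (cases "i = 0") (auto simp: first_unit_def)
  have r: "M $$ (0, j) = (if j = 0 then of_real c else 0)" if "j < Suc n" for j
  proof -
    have "conj_transpose M $$ (j, 0) = (if j = 0 then of_real c else 0)"
      using index_mult_first_unit[of "conj_transpose M" "Suc n" "Suc m" j] M that
      unfolding row by (cases "j = 0") (auto simp: first_unit_def)
    then have "conjugate (conjugate (M $$ (0, j))) = conjugate (if j = 0 then of_real c else 0)"
      using M that by simp
    then show ?thesis by (simp split: if_splits)
  qed
  have "M = direct_sum (real_smult c (1\<^sub>m 1)) B"
  proof (rule eq_matI)
    fix i j assume "i < dim_row (direct_sum (real_smult c (1\<^sub>m 1)) B)"
      "j < dim_col (direct_sum (real_smult c (1\<^sub>m 1)) B)"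
    then have "i < Suc m" "j < Suc n" by (auto simp: B_def)
    then show "M $$ (i, j) = direct_sum (real_smult c (1\<^sub>m 1)) B $$ (i, j)"
      using c r by (cases i; cases j) (auto simp: direct_sum_def B_def)
  qed (use M in \<open>auto simp: B_def\<close>)
  moreover have "B \<in> carrier_mat m n" by (simp add: B_def)
  ultimately show ?thesis by blast
qed

text \<open>The leading pair of singular vectors of \<open>B\<close>, when the second space carries the form \<open>D\<close>.\<close>

lemma max_singular_pair:
  fixes B :: "'a :: star_division mat"
  assumes B: "B \<in> carrier_mat m n" and D: "pos_def n D" and m: "m > 0" and n: "n > 0"
  shows "\<exists>c. \<exists>x\<in>carrier_mat m 1. \<exists>y\<in>carrier_mat n 1. sesq (1\<^sub>m m) x x = 1 \<and> sesq D y y = 1 \<and>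
    B * y = real_smult c x \<and> conj_transpose B * x = real_smult c (D * y)"
proof -
  note cD = pos_def_carrier[OF D]
  \<comment> \<open>The largest eigenvalue of \<open>N\<close> relative to \<open>D\<close> is the
    square of the leading singular value.\<close>
  define N where "N = conj_transpose B * B"
  have N: "N \<in> carrier_mat n n" "conj_transpose N = N"
    using B by (auto simp: N_def conj_transpose_mult)
  have sN: "sesq N z z = sesq (1\<^sub>m m) (B * z) (B * z)" if "z \<in> carrier_mat n 1" for z
    unfolding N_def using sesq_mult_self[OF B that that] .
  obtain l y0 where y0: "y0 \<in> carrier_mat n 1" "y0 \<noteq> 0\<^sub>m n 1" "N * y0 = real_smult l (D * y0)"
    and max: "\<forall>z\<in>carrier_mat n 1. sesq N z z \<le> l * sesq D z z"
    using pencil_max_eigenvalue[OF D N n] by blast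
  obtain r where r: "sesq D (real_smult r y0) (real_smult r y0) = 1"
    using pos_def_normalize[OF D y0(1,2)] by blast
  define y where "y = real_smult r y0"
  have y: "y \<in> carrier_mat n 1" "sesq D y y = 1" using y0 r by (simp_all add: y_def)
  have Ny: "N * y = real_smult l (D * y)"
    using N cD y0 by (simp add: y_def real_smult_mult_right real_smult_real_smult mult.commute)
  have By: "B * y \<in> carrier_mat m 1" using B y by simp
  have l: "sesq (1\<^sub>m m) (B * y) (B * y) = l"
  proof -
    have "sesq N y y = real_part ((conj_transpose y * (N * y)) $$ (0, 0))"
      by (simp add: sesq_def)
    also have "\<dots> = l * sesq D y y"
      unfolding Ny using cD y by (simp add: sesq_def real_smult_mult_right real_part_of_real_mult)
    finally show ?thesis using sN y by simp
  qed
  show ?thesis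
  proof (cases "l > 0")
    case True
    define c where "c = sqrt l"
    have c: "c > 0" "c * c = l" using True by (simp_all add: c_def)
    \<comment> \<open>The normalised image of \<open>y\<close>: its squared length before scaling is
      \<open>l = c * c\<close>.\<close>
    define x where "x = real_smult (1 / c) (B * y)"
    have x: "x \<in> carrier_mat m 1" using By by (simp add: x_def)
    have "sesq (1\<^sub>m m) x x = 1 / c * (1 / c * l)"
      unfolding x_def l[symmetric] using By
      by (simp add: sesq_real_smult_left[of _ m m] sesq_real_smult_right[of _ m m])
    then have "sesq (1\<^sub>m m) x x = 1" using c(1) unfolding c(2)[symmetric] by simp
    moreover have "B * y = real_smult c x"
      using c by (simp add: x_def real_smult_real_smult)
    moreover have "conj_transpose B * x = real_smult c (D * y)"
    proof -
      have "conj_transpose B * x = real_smult (1 / c) (N * y)"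
        using B y by (simp add: x_def N_def real_smult_mult_right mult_mat_assoc)
      moreover have "1 / c * l = c" using c(1) unfolding c(2)[symmetric] by simp
      ultimately show ?thesis by (simp add: Ny real_smult_real_smult)
    qed
    ultimately show ?thesis using x y by blast
  next
    case False
    \<comment> \<open>Degenerate case: a vanishing maximum means that \<open>B\<close> annihilates
      every vector. Then any unit vector \<open>x\<close> will do, with singular value 0.\<close>
    then have l0: "l = 0" using l sesq_one_nonneg[OF By] by simp
    have Bz: "B * z = 0\<^sub>m m 1" if z: "z \<in> carrier_mat n 1" for z
      using max sN[OF z] z B l0 by (intro sesq_one_eq_0) auto
    obtain s where s: "sesq (1\<^sub>m m) (real_smult s (first_unit m)) (real_smult s (first_unit m :: 'a mat)) = 1"
      using pos_def_normalize[OF pos_def_one first_unit_carrier(1) first_unit_neq_0[OF m]] by blast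
    define x :: "'a mat" where "x = real_smult s (first_unit m)"
    have x: "x \<in> carrier_mat m 1" by (simp add: x_def)
    define w where "w = conj_transpose B * x"
    have w: "w \<in> carrier_mat n 1" using B x by (simp add: w_def)
    \<comment> \<open>The squared length of the adjoint image \<open>w\<close> is the value of
      \<open>B\<close> at the pair \<open>x\<close>, \<open>w\<close>, and that value is 0.\<close>
    have "sesq (1\<^sub>m n) w w = sesq (conj_transpose B) w x"
      using w by (simp add: sesq_def w_def[symmetric])
    also have "\<dots> = sesq B x w" by (rule sesq_conj_transpose[OF B x w])
    also have "\<dots> = 0" using x by (simp add: sesq_def Bz[OF w])
    finally have "w = 0\<^sub>m n 1" using sesq_one_eq_0[OF w] by simp
    then have "conj_transpose B * x = real_smult 0 (D * y)"
      using cD y by (simp add: w_def[symmetric] real_smult_0[of _ n 1])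
    moreover have "B * y = real_smult 0 x"
      using x y by (simp add: Bz real_smult_0[of _ m 1])
    moreover have "sesq (1\<^sub>m m) x x = 1" using s by (simp add: x_def)
    ultimately show ?thesis using x y by blast
  qed
qed

text \<open>Positivity of the Hermitian form with blocks \<open>A\<close>, \<open>B\<close>, \<open>D\<close>, stated on pairs of columns.\<close>

definition pos_pair :: "nat \<Rightarrow> nat \<Rightarrow> 'a :: star_division mat \<Rightarrow> 'a mat \<Rightarrow> 'a mat \<Rightarrow> bool" where
  "pos_pair p q A B D \<longleftrightarrow> (\<forall>x\<in>carrier_mat p 1. \<forall>y\<in>carrier_mat q 1.
     (x \<noteq> 0\<^sub>m p 1 \<or> y \<noteq> 0\<^sub>m q 1) \<longrightarrow> sesq A x x + 2 * sesq B x y + sesq D y y > 0)"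

text \<open>Induction on \<open>q\<close>, with \<open>p\<close> dropping along with it. Once a
  singular pair heads the two bases, its two equations make the first column and the first row of
  the transformed \<open>B\<close> multiples of a unit vector. Everything then splits as a direct
  sum, and positivity on pairs is inherited by the complements.\<close>

lemma pos_pair_diagonalization:
  fixes A B D :: "'a :: star_division mat"
  assumes "q \<le> p" "pos_def p A" "pos_def q D" "B \<in> carrier_mat p q" "pos_pair p q A B D"
  shows "\<exists>P\<in>general_linear p. \<exists>Q\<in>general_linear q. \<exists>c :: nat \<Rightarrow> real. (\<forall>i. \<bar>c i\<bar> < 1) \<and>
    conj_transpose P * A * P = 1\<^sub>m p \<and> conj_transpose Q * D * Q = 1\<^sub>m q \<and>
    conj_transpose P * B * Q = real_diag p q c"
  using assms
proof (induction q arbitrary: p A B D)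
  case 0
  obtain P where P: "P \<in> general_linear p" "conj_transpose P * A * P = 1\<^sub>m p"
    using cholesky[OF 0(2)] by blast
  have "conj_transpose (1\<^sub>m 0) * D * 1\<^sub>m 0 = 1\<^sub>m 0"
    using pos_def_carrier[OF 0(3)] by (intro eq_matI) auto
  moreover have "conj_transpose P * B * 1\<^sub>m 0 = real_diag p 0 (\<lambda>_. 0)"
    using general_linear_carrier[OF P(1)] by (intro eq_matI) auto
  ultimately show ?case
    using P general_linear_one
    by (intro bexI[of _ P] bexI[of _ "1\<^sub>m 0"] exI[of _ "\<lambda>_. 0"]) auto
next
  case (Suc q)
  \<comment> \<open>Here \<open>q \<le> p\<close> is used: the first space still has a vector to
    pair with.\<close>
  then obtain p' where p: "p = Suc p'" by (cases p) auto
  note A = Suc.prems(2)[unfolded p] and D = Suc.prems(3) and cB = Suc.prems(4)[unfolded p]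
    and pair = Suc.prems(5)[unfolded p]
  \<comment> \<open>Makes the form on the first space standard, as \<open>max_singular_pair\<close>
    expects.\<close>
  obtain P0 where P0: "P0 \<in> general_linear (Suc p')" "conj_transpose P0 * A * P0 = 1\<^sub>m (Suc p')"
    using cholesky[OF A] by blast
  note c = pos_def_carrier[OF A] pos_def_carrier[OF D] cB general_linear_carrier[OF P0(1)]
  define B0 where "B0 = conj_transpose P0 * B"
  have cB0: "B0 \<in> carrier_mat (Suc p') (Suc q)" using c by (simp add: B0_def)
  obtain l x y where x: "x \<in> carrier_mat (Suc p') 1" "sesq (1\<^sub>m (Suc p')) x x = 1"
    and y: "y \<in> carrier_mat (Suc q) 1" "sesq D y y = 1"
    and B0y: "B0 * y = real_smult l x" and B0x: "conj_transpose B0 * x = real_smult l (D * y)"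
    using max_singular_pair[OF cB0 D] by auto
  have l1: "\<bar>l\<bar> < 1"
  proof -
    have Px: "P0 * x \<in> carrier_mat (Suc p') 1" using c x by simp
    have AP: "sesq A (P0 * x) (P0 * x) = 1"
      using sesq_congruence[OF c(1) c(4) c(4) x(1) x(1)] x(2) P0(2) by simp
    then have nz: "P0 * x \<noteq> 0\<^sub>m (Suc p') 1"
      using c by (auto simp: sesq_def)
    have Bxy: "sesq B (P0 * x) y = l"
    proof -
      have "sesq B (P0 * x) y = real_part ((conj_transpose x * (B0 * y)) $$ (0, 0))"
        using c x y by (simp add: sesq_def B0_def conj_transpose_mult mult_mat_assoc)
      also have "\<dots> = l * sesq (1\<^sub>m (Suc p')) x x"
        unfolding B0y using x by (simp add: sesq_def real_smult_mult_right real_part_of_real_mult)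
      finally show ?thesis using x by simp
    qed
    have "1 + 2 * (t * l) + t * t > 0" for t
    proof -
      have ty: "real_smult t y \<in> carrier_mat (Suc q) 1" using y by simp
      have "sesq A (P0 * x) (P0 * x) + 2 * sesq B (P0 * x) (real_smult t y)
          + sesq D (real_smult t y) (real_smult t y) > 0"
        using pair Px nz ty unfolding pos_pair_def by blast
      moreover have "sesq B (P0 * x) (real_smult t y) = t * l"
        using sesq_real_smult_right[OF c(3) Px y(1)] Bxy by simp
      moreover have "sesq D (real_smult t y) (real_smult t y) = t * t"
        using c(2) y by (simp add: sesq_real_smult_left[of _ "Suc q" "Suc q"]
          sesq_real_smult_right[of _ "Suc q" "Suc q"])
      ultimately show ?thesis using AP by simp
    qed
    \<comment> \<open>At \<open>t = 1\<close> and \<open>t = -1\<close> the form takes the values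
      \<open>2 + 2 * l\<close> and \<open>2 - 2 * l\<close>.\<close>
    from this[of 1] this[of "-1"] show ?thesis by auto
  qed
  obtain P1 A' where P1: "P1 \<in> general_linear (Suc p')" "P1 * first_unit (Suc p') = x"
    and A': "pos_def p' A'" and P1A: "conj_transpose P1 * 1\<^sub>m (Suc p') * P1 = direct_sum (1\<^sub>m 1) A'"
    using pos_def_deflation[OF pos_def_one x] by blast
  obtain Q1 D' where Q1: "Q1 \<in> general_linear (Suc q)" "Q1 * first_unit (Suc q) = y"
    and D': "pos_def q D'" and Q1D: "conj_transpose Q1 * D * Q1 = direct_sum (1\<^sub>m 1) D'"
    using pos_def_deflation[OF D y] by blast
  note c = c general_linear_carrier[OF P1(1)] general_linear_carrier[OF Q1(1)]
    pos_def_carrier[OF A'] pos_def_carrier[OF D'] cB0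
  define P where "P = P0 * P1"
  have P: "P \<in> general_linear (Suc p')"
    unfolding P_def by (rule general_linear_mult[OF P0(1) P1(1)])
  note c = c general_linear_carrier[OF P]
  have PA: "conj_transpose P * A * P = direct_sum (1\<^sub>m 1) A'"
  proof -
    have "conj_transpose P * A * P = conj_transpose P1 * (conj_transpose P0 * A * P0) * P1"
      using c by (simp add: P_def conj_transpose_mult mult_mat_assoc)
    then show ?thesis by (simp add: P0(2) P1A)
  qed
  define M where "M = conj_transpose P * B * Q1"
  have cM: "M \<in> carrier_mat (Suc p') (Suc q)" using c by (simp add: M_def)
  have M: "M = conj_transpose P1 * (B0 * Q1)"
    using c by (simp add: M_def P_def B0_def conj_transpose_mult mult_mat_assoc)
  have ds_first: "direct_sum (1\<^sub>m 1) Z * first_unit (Suc n) = first_unit (Suc n)"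
    if Z: "Z \<in> carrier_mat n n" for Z :: "'a mat" and n
  proof (rule eq_matI)
    have cZ: "direct_sum (1\<^sub>m 1) Z \<in> carrier_mat (Suc n) (Suc n)"
      using direct_sum_carrier[of "1\<^sub>m 1" 1 1 Z n n] Z by simp
    fix i j assume "i < dim_row (first_unit (Suc n) :: 'a mat)" "j < dim_col (first_unit (Suc n) :: 'a mat)"
    then have ij: "i < Suc n" "j = 0" by auto
    have "direct_sum (1\<^sub>m 1) Z $$ (i, 0) = (if i = 0 then 1 else 0)"
      using ij Z by (simp add: direct_sum_def)
    then show "(direct_sum (1\<^sub>m 1) Z * first_unit (Suc n)) $$ (i, j) = first_unit (Suc n) $$ (i, j)"
      using ij index_mult_first_unit[OF cZ ij(1)] by (simp add: first_unit_def)
  qed (use Z in auto)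
  have "M * first_unit (Suc q) = conj_transpose P1 * (B0 * y)"
    unfolding M Q1(2)[symmetric] using c by (simp add: mult_mat_assoc)
  also have "\<dots> = real_smult l (conj_transpose P1 * 1\<^sub>m (Suc p') * P1 * first_unit (Suc p'))"
    unfolding B0y P1(2)[symmetric] using c by (simp add: real_smult_mult_right mult_mat_assoc)
  also have "\<dots> = real_smult l (first_unit (Suc p'))"
    unfolding P1A using ds_first[OF pos_def_carrier[OF A']] by simp
  finally have M_col: "M * first_unit (Suc q) = real_smult l (first_unit (Suc p'))" .
  have "conj_transpose M * first_unit (Suc p') = conj_transpose Q1 * (conj_transpose B0 * x)"
    unfolding M P1(2)[symmetric] using c by (simp add: conj_transpose_mult mult_mat_assoc)
  also have "\<dots> = real_smult l (conj_transpose Q1 * D * Q1 * first_unit (Suc q))"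
    unfolding B0x Q1(2)[symmetric] using c by (simp add: real_smult_mult_right mult_mat_assoc)
  also have "\<dots> = real_smult l (first_unit (Suc q))"
    unfolding Q1D using ds_first[OF pos_def_carrier[OF D']] by simp
  finally have M_row: "conj_transpose M * first_unit (Suc p') = real_smult l (first_unit (Suc q))" .
  obtain B' where B': "B' \<in> carrier_mat p' q" and MB: "M = direct_sum (real_smult l (1\<^sub>m 1)) B'"
    using direct_sum_if_first_unit[OF cM M_col M_row] by blast
  have "pos_pair p' q A' B' D'"
    unfolding pos_pair_def
  proof (intro ballI impI)
    fix u v :: "'a mat"
    assume u: "u \<in> carrier_mat p' 1" and v: "v \<in> carrier_mat q 1"
      and nz: "u \<noteq> 0\<^sub>m p' 1 \<or> v \<noteq> 0\<^sub>m q 1"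
    \<comment> \<open>Prepending a zero entry embeds the complements into the full spaces, where
      positivity is known.\<close>
    define u0 v0 where "u0 = direct_sum (0\<^sub>m 1 0) u" and "v0 = direct_sum (0\<^sub>m 1 0) v"
    have u0: "u0 \<in> carrier_mat (Suc p') 1" and v0: "v0 \<in> carrier_mat (Suc q) 1"
      using u v by (simp_all add: u0_def v0_def direct_sum_zero_column_carrier del: One_nat_def)
    have "P * u0 \<noteq> 0\<^sub>m (Suc p') 1 \<or> Q1 * v0 \<noteq> 0\<^sub>m (Suc q) 1"
      using nz general_linear_mult_eq_0[OF P u0] general_linear_mult_eq_0[OF Q1(1) v0]
        direct_sum_zero_column_eq_0[OF u] direct_sum_zero_column_eq_0[OF v]
      by (auto simp: u0_def v0_def)
    moreover have "P * u0 \<in> carrier_mat (Suc p') 1" "Q1 * v0 \<in> carrier_mat (Suc q) 1"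
      using c u0 v0 by simp_all
    ultimately have "sesq A (P * u0) (P * u0) + 2 * sesq B (P * u0) (Q1 * v0)
        + sesq D (Q1 * v0) (Q1 * v0) > 0"
      using pair unfolding pos_pair_def by blast
    moreover have "sesq A (P * u0) (P * u0) = sesq A' u u"
      using sesq_congruence[OF c(1) c(10) c(10) u0 u0] u pos_def_carrier[OF A']
      by (simp add: PA u0_def sesq_direct_sum_zero_column[of _ _ p' p'] del: One_nat_def)
    moreover have "sesq B (P * u0) (Q1 * v0) = sesq B' u v"
      using sesq_congruence[OF c(3) c(10) c(6) u0 v0] u v B'
      by (simp add: M_def[symmetric] MB u0_def v0_def sesq_direct_sum_zero_column[of _ _ p' q] del: One_nat_def)
    moreover have "sesq D (Q1 * v0) (Q1 * v0) = sesq D' v v"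
      using sesq_congruence[OF c(2) c(6) c(6) v0 v0] v pos_def_carrier[OF D']
      by (simp add: Q1D v0_def sesq_direct_sum_zero_column[of _ _ q q] del: One_nat_def)
    ultimately show "sesq A' u u + 2 * sesq B' u v + sesq D' v v > 0" by simp
  qed
  then obtain P' Q' c' where P': "P' \<in> general_linear p'" and Q': "Q' \<in> general_linear q"
    and c': "\<forall>i. \<bar>c' i\<bar> < 1" and PA': "conj_transpose P' * A' * P' = 1\<^sub>m p'"
    and QD': "conj_transpose Q' * D' * Q' = 1\<^sub>m q"
    and PBQ': "conj_transpose P' * B' * Q' = real_diag p' q c'"
    using Suc.IH[of p' A' D' B'] Suc.prems(1) p A' D' B' by auto
  define R S where "R = direct_sum (1\<^sub>m 1) P'" and "S = direct_sum (1\<^sub>m 1) Q'"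
  have R: "R \<in> general_linear (Suc p')" and S: "S \<in> general_linear (Suc q)"
    using general_linear_direct_sum[OF general_linear_one P', of 1]
      general_linear_direct_sum[OF general_linear_one Q', of 1] by (simp_all add: R_def S_def)
  note c = c B' general_linear_carrier[OF P'] general_linear_carrier[OF Q']
    general_linear_carrier[OF R] general_linear_carrier[OF S]
  have "conj_transpose (P * R) * A * (P * R) = conj_transpose R * (conj_transpose P * A * P) * R"
    using c by (simp add: conj_transpose_mult mult_mat_assoc)
  also have "\<dots> = direct_sum (1\<^sub>m 1) (conj_transpose P' * A' * P')"
    unfolding PA R_def using c by (simp add: conj_transpose_direct_sum direct_sum_mult)
  finally have 1: "conj_transpose (P * R) * A * (P * R) = 1\<^sub>m p"
    by (simp add: PA' direct_sum_one p)
  have "conj_transpose (Q1 * S) * D * (Q1 * S) = conj_transpose S * (conj_transpose Q1 * D * Q1) * S"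
    using c by (simp add: conj_transpose_mult mult_mat_assoc)
  also have "\<dots> = direct_sum (1\<^sub>m 1) (conj_transpose Q' * D' * Q')"
    unfolding Q1D S_def using c by (simp add: conj_transpose_direct_sum direct_sum_mult)
  finally have 2: "conj_transpose (Q1 * S) * D * (Q1 * S) = 1\<^sub>m (Suc q)"
    by (simp add: QD' direct_sum_one)
  have "conj_transpose (P * R) * B * (Q1 * S) = conj_transpose R * M * S"
    using c by (simp add: M_def conj_transpose_mult mult_mat_assoc)
  also have "\<dots> = direct_sum (real_smult l (1\<^sub>m 1)) (conj_transpose P' * B' * Q')"
    unfolding MB R_def S_def using c by (simp add: conj_transpose_direct_sum direct_sum_mult)
  finally have 3: "conj_transpose (P * R) * B * (Q1 * S) = real_diag p (Suc q) (case_nat l c')"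
    by (simp only: PBQ' real_diag_Suc p)
  have 4: "\<forall>i. \<bar>case_nat l c' i\<bar> < 1"
    using l1 c' by (auto split: nat.split)
  show ?case
    using general_linear_mult[OF P R] general_linear_mult[OF Q1(1) S] 1 2 3 4 p by blast
qed

section \<open>Existence of the decomposition\<close>

lemma hyperbolic_mat_blocks:
  assumes "q \<le> p"
  shows "hyperbolic_mat p q \<theta> = four_block_mat
    (real_diag p p (\<lambda>i. if i < q then cosh (\<theta> i) else 1)) (real_diag p q (\<lambda>i. sinh (\<theta> i)))
    (real_diag q p (\<lambda>i. sinh (\<theta> i))) (real_diag q q (\<lambda>i. cosh (\<theta> i)))"
    (is "_ = ?B")
proof (rule eq_matI)
  fix i j assume "i < dim_row ?B" "j < dim_col ?B"
  then have "i < p + q" "j < p + q" by auto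
  then show "hyperbolic_mat p q \<theta> $$ (i, j) = ?B $$ (i, j)"
    using assms by (subst hyperbolic_mat_index) (auto simp: real_diag_def)
qed (use assms in \<open>auto simp: hyperbolic_mat_def Ch_def Sh_def mat_diag_def append_rows_def\<close>)

lemma hyperbolic_mat_carrier:
  assumes "q \<le> p"
  shows "(hyperbolic_mat p q \<theta> :: 'a :: star_division mat) \<in> carrier_mat (p + q) (p + q)"
  unfolding hyperbolic_mat_blocks[OF assms] by simp

lemma conj_transpose_hyperbolic_mat:
  assumes "q \<le> p"
  shows "conj_transpose (hyperbolic_mat p q \<theta>) = (hyperbolic_mat p q \<theta> :: 'a :: star_division mat)"
  unfolding hyperbolic_mat_blocks[OF assms]
  by (rule eq_matI) (auto simp: real_diag_def)

text \<open>The addition theorems of cosh and sinh, applied to each coordinate pair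
  \<open>i\<close>, \<open>p + i\<close>. Square roots and inverses are thus obtained by halving or
  negating the parameters.\<close>

lemma hyperbolic_mat_mult:
  assumes "q \<le> p"
  shows "hyperbolic_mat p q \<theta> * hyperbolic_mat p q \<phi> =
    (hyperbolic_mat p q (\<lambda>i. \<theta> i + \<phi> i) :: 'a :: star_division mat)"
  unfolding hyperbolic_mat_blocks[OF assms]
  by (subst mult_four_block_mat[of _ p p _ q _ q _ _ p _ q])
    (use assms in \<open>auto simp: real_diag_mult real_diag_add cosh_add sinh_add
      intro!: cong_four_block_mat real_diag_cong\<close>)

lemma hyperbolic_mat_0:
  assumes "q \<le> p" "\<And>i. \<theta> i = 0"
  shows "hyperbolic_mat p q \<theta> = (1\<^sub>m (p + q) :: 'a :: star_division mat)"
  unfolding hyperbolic_mat_blocks[OF assms(1)]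
  by (rule eq_matI) (auto simp: real_diag_def assms(2))

lemma tanh_surj:
  assumes "\<bar>c :: real\<bar> < 1"
  shows "\<exists>t. cosh t * c = sinh t"
proof -
  \<comment> \<open>The exponential of artanh \<open>c\<close>.\<close>
  define x where "x = sqrt ((1 + c) / (1 - c))"
  have x: "x > 0" "x\<^sup>2 = (1 + c) / (1 - c)"
    using assms by (auto simp: x_def)
  have "tanh (ln x) = (x\<^sup>2 - 1) / (x\<^sup>2 + 1)"
    by (rule tanh_ln_real[OF x(1)])
  also have "\<dots> = c"
    unfolding x(2) using assms by (auto simp: divide_simps)
  finally have "cosh (ln x) * c = sinh (ln x)"
    using cosh_real_pos[of "ln x"] by (simp add: tanh_def field_simps)
  then show ?thesis by blast
qed

text \<open>A relation between the two column blocks is a kernel vector of \<open>G\<close>. Block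
  matrices with empty blocks are used to stack \<open>x\<close> over \<open>y\<close> and to put
  \<open>Gl\<close> beside \<open>Gr\<close>.\<close>

lemma general_linear_columns_independent:
  fixes G :: "'a :: star_division mat"
  assumes G: "G \<in> general_linear (p + q)"
    and Gl: "Gl = mat (p + q) p (\<lambda>(i, j). G $$ (i, j))"
    and Gr: "Gr = mat (p + q) q (\<lambda>(i, j). G $$ (i, j + p))"
    and x: "x \<in> carrier_mat p 1" and y: "y \<in> carrier_mat q 1"
    and 0: "Gl * x + Gr * y = 0\<^sub>m (p + q) 1"
  shows "x = 0\<^sub>m p 1" "y = 0\<^sub>m q 1"
proof -
  define v where "v = four_block_mat x (0\<^sub>m p 0) y (0\<^sub>m q 0)"
  have v: "v \<in> carrier_mat (p + q) 1"
    using x y by (auto simp: v_def intro!: carrier_matI)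
  have Geq: "G = four_block_mat Gl Gr (0\<^sub>m 0 p) (0\<^sub>m 0 q)"
    using general_linear_carrier[OF G] by (intro eq_matI) (auto simp: Gl Gr)
  have "G * v = four_block_mat (Gl * x + Gr * y) (Gl * 0\<^sub>m p 0 + Gr * 0\<^sub>m q 0)
      (0\<^sub>m 0 p * x + 0\<^sub>m 0 q * y) (0\<^sub>m 0 p * 0\<^sub>m p 0 + 0\<^sub>m 0 q * 0\<^sub>m q 0)"
    unfolding v_def by (subst Geq, rule mult_four_block_mat) (use x y in \<open>auto simp: Gl Gr\<close>)
  also have "\<dots> = 0\<^sub>m (p + q) 1"
    unfolding 0 using x y by (intro eq_matI) (auto simp: Gl Gr)
  finally have "v = 0\<^sub>m (p + q) 1"
    by (rule general_linear_mult_eq_0[OF G v])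
  then have v0: "v $$ (i, 0) = 0" if "i < p + q" for i using that by simp
  show "x = 0\<^sub>m p 1"
  proof (rule eq_matI)
    fix i j assume "i < dim_row (0\<^sub>m p 1 :: 'a mat)" "j < dim_col (0\<^sub>m p 1 :: 'a mat)"
    then show "x $$ (i, j) = 0\<^sub>m p 1 $$ (i, j)"
      using v0[of i] x y by (simp add: v_def)
  qed (use x in auto)
  show "y = 0\<^sub>m q 1"
  proof (rule eq_matI)
    fix i j assume "i < dim_row (0\<^sub>m q 1 :: 'a mat)" "j < dim_col (0\<^sub>m q 1 :: 'a mat)"
    then show "y $$ (i, j) = 0\<^sub>m q 1 $$ (i, j)"
      using v0[of "p + i"] x y by (simp add: v_def)
  qed (use y in auto)
qed

lemma hyperbolic_decomposition_exists:
  fixes G :: "'a :: star_division mat"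
  assumes qp: "q \<le> p" and G: "G \<in> general_linear (p + q)"
  shows "\<exists>\<theta> U Gp Gq. hyperbolic_decomposition p q G \<theta> U Gp Gq"
proof -
  define Gl where "Gl = mat (p + q) p (\<lambda>(i, j). G $$ (i, j))"
  define Gr where "Gr = mat (p + q) q (\<lambda>(i, j). G $$ (i, j + p))"
  have cG: "G \<in> carrier_mat (p + q) (p + q)" "Gl \<in> carrier_mat (p + q) p" "Gr \<in> carrier_mat (p + q) q"
    using general_linear_carrier[OF G] by (simp_all add: Gl_def Gr_def)
  define A where "A = conj_transpose Gl * Gl"
  define B where "B = conj_transpose Gl * Gr"
  define D where "D = conj_transpose Gr * Gr"
  have cABD: "A \<in> carrier_mat p p" "B \<in> carrier_mat p q" "D \<in> carrier_mat q q"
    using cG by (simp_all add: A_def B_def D_def)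
  have GG: "conj_transpose G * G = four_block_mat A B (conj_transpose B) D"
  proof -
    have zero_prod: "0\<^sub>m k 0 * 0\<^sub>m 0 l = (0\<^sub>m k l :: 'a mat)" for k l by auto
    have 1: "G = four_block_mat Gl Gr (0\<^sub>m 0 p) (0\<^sub>m 0 q)"
      using cG by (intro eq_matI) (auto simp: Gl_def Gr_def)
    have 2: "conj_transpose G = four_block_mat (conj_transpose Gl) (0\<^sub>m p 0) (conj_transpose Gr) (0\<^sub>m q 0)"
      using cG by (intro eq_matI) (auto simp: Gl_def Gr_def)
    have "conj_transpose G * G = four_block_mat (A + 0\<^sub>m p 0 * 0\<^sub>m 0 p) (B + 0\<^sub>m p 0 * 0\<^sub>m 0 q)
        (conj_transpose Gr * Gl + 0\<^sub>m q 0 * 0\<^sub>m 0 p) (D + 0\<^sub>m q 0 * 0\<^sub>m 0 q)"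
      unfolding A_def B_def D_def
      by (subst 2, subst 1, rule mult_four_block_mat) (use cG in auto)
    also have "conj_transpose Gr * Gl = conj_transpose B"
      using cG by (simp add: B_def conj_transpose_mult)
    finally show ?thesis using cABD by (simp add: zero_prod)
  qed
  have pair: "pos_pair p q A B D"
    unfolding pos_pair_def
  proof (intro ballI impI)
    fix x y :: "'a mat"
    assume x: "x \<in> carrier_mat p 1" and y: "y \<in> carrier_mat q 1"
      and nz: "x \<noteq> 0\<^sub>m p 1 \<or> y \<noteq> 0\<^sub>m q 1"
    define u where "u = Gl * x"
    define v where "v = Gr * y"
    have uv: "u \<in> carrier_mat (p + q) 1" "v \<in> carrier_mat (p + q) 1"
      using cG x y by (simp_all add: u_def v_def)
    \<comment> \<open>The form on the pair \<open>x\<close>, \<open>y\<close> is the squared length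
      of \<open>Gl * x + Gr * y\<close>, so independence of the columns makes it positive.\<close>
    have "u + v \<noteq> 0\<^sub>m (p + q) 1"
      using general_linear_columns_independent[OF G Gl_def Gr_def x y] nz by (auto simp: u_def v_def)
    then have "\<not> sesq (1\<^sub>m (p + q)) (u + v) (u + v) \<le> 0"
      using sesq_one_eq_0[of "u + v" "p + q"] uv by auto
    moreover have "sesq (1\<^sub>m (p + q)) (u + v) (u + v) =
        sesq (1\<^sub>m (p + q)) u u + 2 * sesq (1\<^sub>m (p + q)) u v + sesq (1\<^sub>m (p + q)) v v"
      using uv sesq_conj_transpose[of "1\<^sub>m (p + q)" "p + q" "p + q" u v]
      by (simp add: sesq_add_left[of _ "p + q" "p + q"] sesq_add_right[of _ "p + q" "p + q"])
    moreover have "sesq (1\<^sub>m (p + q)) u u = sesq A x x"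
      using sesq_congruence[OF one_carrier_mat cG(2) cG(2) x x] cG by (simp add: u_def A_def)
    moreover have "sesq (1\<^sub>m (p + q)) u v = sesq B x y"
      using sesq_congruence[OF one_carrier_mat cG(2) cG(3) x y] cG by (simp add: u_def v_def B_def)
    moreover have "sesq (1\<^sub>m (p + q)) v v = sesq D y y"
      using sesq_congruence[OF one_carrier_mat cG(3) cG(3) y y] cG by (simp add: v_def D_def)
    ultimately show "sesq A x x + 2 * sesq B x y + sesq D y y > 0" by simp
  qed
  have "sesq A x x > 0" if x: "x \<in> carrier_mat p 1" "x \<noteq> 0\<^sub>m p 1" for x
  proof -
    have "sesq A x x + 2 * sesq B x (0\<^sub>m q 1) + sesq D (0\<^sub>m q 1) (0\<^sub>m q 1) > 0"
      using pair x zero_carrier_mat unfolding pos_pair_def by blast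
    then show ?thesis using x cABD by (simp add: sesq_def)
  qed
  then have A: "pos_def p A"
    using cABD cG by (simp add: pos_def_def A_def conj_transpose_mult)
  have "sesq D y y > 0" if y: "y \<in> carrier_mat q 1" "y \<noteq> 0\<^sub>m q 1" for y
  proof -
    have "sesq A (0\<^sub>m p 1) (0\<^sub>m p 1) + 2 * sesq B (0\<^sub>m p 1) y + sesq D y y > 0"
      using pair y zero_carrier_mat unfolding pos_pair_def by blast
    then show ?thesis using y cABD by (simp add: sesq_def)
  qed
  then have D: "pos_def q D"
    using cABD cG by (simp add: pos_def_def D_def conj_transpose_mult)
  obtain P Q c where P: "P \<in> general_linear p" and Q: "Q \<in> general_linear q"
    and c: "\<forall>i :: nat. \<bar>c i\<bar> < 1" and PA: "conj_transpose P * A * P = 1\<^sub>m p"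
    and QD: "conj_transpose Q * D * Q = 1\<^sub>m q" and PB: "conj_transpose P * B * Q = real_diag p q c"
    using pos_pair_diagonalization[OF qp A D cABD(2) pair] by blast
  have "\<forall>i. \<exists>t. cosh t * c i = sinh t" using tanh_surj c by blast
  \<comment> \<open>\<open>t i\<close> is twice the parameter that is sought; the halving takes
    place at the end.\<close>
  then obtain t where t: "cosh (t i) * c i = sinh (t i)" for i
    unfolding choice_iff by blast
  define s where "s i = sqrt (cosh (t i))" for i
  have ss: "s i * s i = cosh (t i)" and s0: "s i > 0" for i
    using cosh_real_pos[of "t i"] by (simp_all add: s_def)
  \<comment> \<open>Basis vectors of the first space without a partner keep length 1 and produce the
    identity block of size \<open>p - q\<close>.\<close>
  define Sp :: "'a mat" where "Sp = real_diag p p (\<lambda>i. if i < q then s i else 1)"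
  define Sq :: "'a mat" where "Sq = real_diag q q s"
  have Sp: "Sp \<in> general_linear p"
    unfolding general_linear_iff Sp_def
    by (intro conjI bexI[of _ "real_diag p p (\<lambda>i. if i < q then 1 / s i else 1)"])
      (use s0 in \<open>auto simp: real_diag_mult less_imp_neq[THEN not_sym] intro!: trans[OF real_diag_cong real_diag_one]\<close>)
  have Sq: "Sq \<in> general_linear q"
    unfolding general_linear_iff Sq_def
    by (intro conjI bexI[of _ "real_diag q q (\<lambda>i. 1 / s i)"])
      (use s0 in \<open>auto simp: real_diag_mult less_imp_neq[THEN not_sym] intro!: trans[OF real_diag_cong real_diag_one]\<close>)
  have PSp: "P * Sp \<in> general_linear p" and QSq: "Q * Sq \<in> general_linear q"
    using general_linear_mult P Q Sp Sq by auto
  note cPQ = general_linear_carrier[OF P] general_linear_carrier[OF Q]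
    general_linear_carrier[OF Sp] general_linear_carrier[OF Sq]
  define K where "K = direct_sum (P * Sp) (Q * Sq)"
  have K: "K \<in> carrier_mat (p + q) (p + q)"
    using cPQ by (simp add: K_def)
  have "conj_transpose K * (conj_transpose G * G) * K = hyperbolic_mat p q t"
  proof -
    have 1: "conj_transpose K * (conj_transpose G * G) * K = four_block_mat
        (conj_transpose (P * Sp) * A * (P * Sp)) (conj_transpose (P * Sp) * B * (Q * Sq))
        (conj_transpose (Q * Sq) * conj_transpose B * (P * Sp)) (conj_transpose (Q * Sq) * D * (Q * Sq))"
      unfolding GG K_def conj_transpose_direct_sum using cPQ cABD
      by (simp add: direct_sum_mult_four_block_mat[of _ p p _ q _ q _ _ p _ q])
        (subst four_block_mat_mult_direct_sum[of _ p p _ q _ q _ _ p _ q], auto)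
    have 2: "conj_transpose (P * Sp) * A * (P * Sp) = real_diag p p (\<lambda>i. if i < q then cosh (t i) else 1)"
    proof -
      have "conj_transpose (P * Sp) * A * (P * Sp) = conj_transpose Sp * (conj_transpose P * A * P) * Sp"
        using cPQ cABD by (simp add: conj_transpose_mult mult_mat_assoc)
      then show ?thesis
        unfolding PA using cPQ by (auto simp: Sp_def real_diag_mult ss intro!: real_diag_cong)
    qed
    have 3: "conj_transpose (P * Sp) * B * (Q * Sq) = real_diag p q (\<lambda>i. sinh (t i))"
    proof -
      have "conj_transpose (P * Sp) * B * (Q * Sq) = conj_transpose Sp * (conj_transpose P * B * Q) * Sq"
        using cPQ cABD by (simp add: conj_transpose_mult mult_mat_assoc)
      moreover have "s i * c i * s i = sinh (t i)" for i
        using t[of i] by (simp add: ss[symmetric] mult_ac)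
      ultimately show ?thesis
        unfolding PB by (auto simp: Sp_def Sq_def real_diag_mult intro!: real_diag_cong)
    qed
    have 4: "conj_transpose (Q * Sq) * conj_transpose B * (P * Sp) = real_diag q p (\<lambda>i. sinh (t i))"
    proof -
      have "conj_transpose (Q * Sq) * conj_transpose B * (P * Sp) =
          conj_transpose (conj_transpose (P * Sp) * B * (Q * Sq))"
        using cPQ cABD by (simp add: conj_transpose_mult mult_mat_assoc)
      then show ?thesis by (simp add: 3)
    qed
    have 5: "conj_transpose (Q * Sq) * D * (Q * Sq) = real_diag q q (\<lambda>i. cosh (t i))"
    proof -
      have "conj_transpose (Q * Sq) * D * (Q * Sq) = conj_transpose Sq * (conj_transpose Q * D * Q) * Sq"
        using cPQ cABD by (simp add: conj_transpose_mult mult_mat_assoc)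
      then show ?thesis
        unfolding QD using cPQ by (auto simp: Sq_def real_diag_mult ss intro!: real_diag_cong)
    qed
    show ?thesis unfolding 1 2 3 4 5 hyperbolic_mat_blocks[OF qp] ..
  qed
  note KGGK = this
  obtain Gp where Gp: "Gp \<in> carrier_mat p p" "P * Sp * Gp = 1\<^sub>m p" "Gp * (P * Sp) = 1\<^sub>m p"
    using PSp by (auto simp: general_linear_iff)
  obtain Gq where Gq: "Gq \<in> carrier_mat q q" "Q * Sq * Gq = 1\<^sub>m q" "Gq * (Q * Sq) = 1\<^sub>m q"
    using QSq by (auto simp: general_linear_iff)
  have GL: "Gp \<in> general_linear p" "Gq \<in> general_linear q"
    using PSp QSq Gp Gq general_linear_carrier by (auto simp: general_linear_iff)
  define L where "L = direct_sum Gp Gq"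
  have L: "L \<in> carrier_mat (p + q) (p + q)" using Gp Gq by (simp add: L_def)
  have KL: "K * L = 1\<^sub>m (p + q)"
    using Gp Gq cPQ by (simp add: K_def L_def direct_sum_mult direct_sum_one)
  \<comment> \<open>A one-parameter group: \<open>H 1\<close> is the rescaled Gram matrix,
    \<open>H (1/2)\<close> the desired middle factor.\<close>
  define H :: "real \<Rightarrow> 'a mat" where "H r = hyperbolic_mat p q (\<lambda>i. r * t i)" for r
  have cH: "H r \<in> carrier_mat (p + q) (p + q)" for r
    by (simp add: H_def hyperbolic_mat_carrier[OF qp])
  have H_mult: "H r * H r' = H (r + r')" for r r'
    by (simp add: H_def hyperbolic_mat_mult[OF qp] distrib_right)
  have H_0: "H 0 = 1\<^sub>m (p + q)" by (simp add: H_def hyperbolic_mat_0[OF qp])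
  have H_conj: "conj_transpose (H r) = H r" for r
    by (simp add: H_def conj_transpose_hyperbolic_mat[OF qp])
  \<comment> \<open>The columns of \<open>G * K\<close> have Gram matrix \<open>H 1\<close>;
    multiplying by its inverse square root makes them orthonormal.\<close>
  define U where "U = G * K * H (- (1/2))"
  have cU: "U \<in> carrier_mat (p + q) (p + q)"
    unfolding U_def by (intro mult_carrier_mat[of _ _ "p + q"] cG K cH)
  have "conj_transpose U * U = H (- (1/2)) * (conj_transpose K * (conj_transpose G * G) * K) * H (- (1/2))"
    using cG K cH[of "- (1/2)"]
    by (simp add: U_def conj_transpose_mult mult_mat_assoc H_conj)
  also have "\<dots> = H (- (1/2)) * H 1 * H (- (1/2))"
    unfolding KGGK by (simp add: H_def)
  also have "\<dots> = 1\<^sub>m (p + q)" by (simp add: H_mult H_0)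
  finally have U: "U \<in> unitary_group (p + q)" using cU by (simp add: unitary_group_def)
  have "U * H (1/2) * L = G * K * (H (- (1/2)) * H (1/2)) * L"
    using cG K cH[of "- (1/2)"] cH[of "1/2"] L by (simp add: U_def mult_mat_assoc)
  also have "\<dots> = G * (K * L)"
    using cG K L by (simp add: H_mult H_0 mult_mat_assoc)
  also have "\<dots> = G" using cG by (simp add: KL)
  finally have "G = U * hyperbolic_mat p q (\<lambda>i. 1/2 * t i) * four_block_mat Gp (0\<^sub>m p q) (0\<^sub>m q p) Gq"
    using Gp Gq by (simp add: H_def L_def direct_sum_def)
  then have "hyperbolic_decomposition p q G (\<lambda>i. 1/2 * t i) U Gp Gq"
    unfolding hyperbolic_decomposition_def using U GL by blast
  then show ?thesis by blast
qed

section \<open>Uniqueness of the parameters\<close>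

text \<open>Gaussian elimination, by induction on the equations. With coefficients to the left of
  the unknowns, it works over any division ring: an equation with a nonzero coefficient is solved
  for one unknown, which is then substituted.\<close>

lemma homogeneous_system_nontrivial:
  fixes S :: "'i \<Rightarrow> 'j \<Rightarrow> 'a :: division_ring"
  assumes "finite I" "finite J" "card I < card J"
  shows "\<exists>x. (\<exists>j\<in>J. x j \<noteq> 0) \<and> (\<forall>i\<in>I. (\<Sum>j\<in>J. S i j * x j) = 0)"
  using assms
proof (induction I arbitrary: J S rule: finite_induct)
  case empty
  then have "J \<noteq> {}" by auto
  then show ?case by (intro exI[of _ "\<lambda>_. 1"]) auto
next
  case (insert i I)
  show ?case
  proof (cases "\<forall>j\<in>J. S i j = 0")
    case True
    have "card I < card J" using insert by simp
    then obtain x where "\<exists>j\<in>J. x j \<noteq> 0" "\<forall>i\<in>I. (\<Sum>j\<in>J. S i j * x j) = 0"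
      using insert.IH[OF insert.prems(1), of S] by blast
    with True show ?thesis by (intro exI[of _ x]) auto
  next
    case False
    then obtain k where k: "k \<in> J" "S i k \<noteq> 0" by blast
    define J' where "J' = J - {k}"
    have J': "finite J'" "card I < card J'" "k \<notin> J'" "J = insert k J'"
      using insert k by (auto simp: J'_def)
    \<comment> \<open>The coefficients left after eliminating the unknown \<open>k\<close> by
      equation \<open>i\<close>; \<open>z\<close> below is the value recovered for that
      unknown.\<close>
    define S' where "S' a j = S a j - S a k * (inverse (S i k) * S i j)" for a j
    obtain x where x: "\<exists>j\<in>J'. x j \<noteq> 0" "\<forall>a\<in>I. (\<Sum>j\<in>J'. S' a j * x j) = 0"
      using insert.IH[OF J'(1,2), of S'] by blast
    define z where "z = - (inverse (S i k) * (\<Sum>j\<in>J'. S i j * x j))"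
    define y where "y = x(k := z)"
    have y: "(\<Sum>j\<in>J. S a j * y j) = S a k * z + (\<Sum>j\<in>J'. S a j * x j)" for a
    proof -
      have "(\<Sum>j\<in>J'. S a j * y j) = (\<Sum>j\<in>J'. S a j * x j)"
        using J'(3) by (intro sum.cong) (auto simp: y_def)
      then show ?thesis
        unfolding J'(4) using J'(1,3) by (simp add: y_def)
    qed
    have "(\<Sum>j\<in>J. S i j * y j) = 0"
      unfolding y using k(2) by (simp add: z_def mult.assoc[symmetric])
    moreover have "(\<Sum>j\<in>J. S a j * y j) = 0" if a: "a \<in> I" for a
    proof -
      have "(\<Sum>j\<in>J'. S' a j * x j) = (\<Sum>j\<in>J'. S a j * x j) + S a k * z"
        unfolding S'_def z_def
        by (simp add: left_diff_distrib sum_subtractf sum_distrib_left mult.assoc)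
      then show ?thesis unfolding y using x(2) a by (simp add: add.commute)
    qed
    moreover have "\<exists>j\<in>J. y j \<noteq> 0"
      using x(1) J'(3,4) by (auto simp: y_def)
    ultimately show ?thesis by auto
  qed
qed

text \<open>By \<open>supp\<close>, the columns of \<open>X\<close> with index in \<open>J\<close>
  vanish outside the rows in \<open>I\<close>. Were \<open>J\<close> larger, fewer equations than
  unknowns would give a nontrivial vanishing combination of these columns, contrary to
  invertibility.\<close>

lemma level_set_card_le:
  fixes X :: "'a :: division_ring mat" and d e :: "nat \<Rightarrow> 'b"
  assumes X: "X \<in> general_linear q"
    and supp: "\<And>i j. i < q \<Longrightarrow> j < q \<Longrightarrow> X $$ (i, j) \<noteq> 0 \<Longrightarrow> d i = e j"
  shows "card {j. j < q \<and> e j = v} \<le> card {i. i < q \<and> d i = v}"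
proof (rule ccontr)
  define I where "I = {i. i < q \<and> d i = v}"
  define J where "J = {j. j < q \<and> e j = v}"
  assume "\<not> card {j. j < q \<and> e j = v} \<le> card {i. i < q \<and> d i = v}"
  then obtain x where x: "\<exists>j\<in>J. x j \<noteq> 0" "\<forall>i\<in>I. (\<Sum>j\<in>J. X $$ (i, j) * x j) = 0"
    using homogeneous_system_nontrivial[of I J "\<lambda>i j. X $$ (i, j)"] by (auto simp: I_def J_def)
  define w where "w = mat q 1 (\<lambda>(i, j). if i \<in> J then x i else 0)"
  have w: "w \<in> carrier_mat q 1" by (simp add: w_def)
  have "X * w = 0\<^sub>m q 1"
  proof (rule eq_matI)
    fix i k assume "i < dim_row (0\<^sub>m q 1 :: 'a mat)" "k < dim_col (0\<^sub>m q 1 :: 'a mat)"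
    then have ik: "i < q" "k = 0" by auto
    have "(X * w) $$ (i, k) = (\<Sum>j\<in>{0..<q}. X $$ (i, j) * (if j \<in> J then x j else 0))"
      using ik general_linear_carrier[OF X] by (auto simp: w_def scalar_prod_def intro!: sum.cong)
    also have "\<dots> = (\<Sum>j\<in>J. X $$ (i, j) * x j)"
      by (rule sum.mono_neutral_cong_right) (auto simp: J_def)
    also have "\<dots> = 0"
    proof (cases "i \<in> I")
      case False
      then have "X $$ (i, j) = 0" if "j \<in> J" for j
        using that supp[of i j] ik by (auto simp: I_def J_def)
      then show ?thesis by simp
    qed (use x in blast)
    finally show "(X * w) $$ (i, k) = 0\<^sub>m q 1 $$ (i, k)" using ik by simp
  qed (use general_linear_carrier[OF X] w in auto)
  then have "w = 0\<^sub>m q 1" by (rule general_linear_mult_eq_0[OF X w])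
  moreover obtain j where "j \<in> J" "x j \<noteq> 0" using x by blast
  moreover have "w $$ (j, 0) = x j" "j < q" using \<open>j \<in> J\<close> by (auto simp: w_def J_def)
  ultimately show False by simp
qed

text \<open>One-sided counting suffices: every value is taken by \<open>e\<close> at most as often
  as by \<open>d\<close>, and both have \<open>q\<close> values in total, so the multisets
  agree.\<close>

lemma support_permutes:
  fixes X :: "'a :: division_ring mat" and d e :: "nat \<Rightarrow> 'b"
  assumes X: "X \<in> general_linear q"
    and supp: "\<And>i j. i < q \<Longrightarrow> j < q \<Longrightarrow> X $$ (i, j) \<noteq> 0 \<Longrightarrow> d i = e j"
  shows "\<exists>\<pi>. \<pi> permutes {..<q} \<and> (\<forall>i<q. d i = e (\<pi> i))"
proof -
  have count: "count (image_mset f (mset_set {..<q})) v = card {j. j < q \<and> f j = v}"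
    for f :: "nat \<Rightarrow> 'b" and v
  proof -
    have "{x. x < q \<and> v = f x} = {j. j < q \<and> f j = v}" by auto
    then show ?thesis by (simp add: count_image_mset')
  qed
  have "image_mset e (mset_set {..<q}) \<subseteq># image_mset d (mset_set {..<q})"
    using level_set_card_le[OF X, of d e] supp by (intro mset_subset_eqI) (simp add: count)
  moreover have "size (image_mset e (mset_set {..<q})) = size (image_mset d (mset_set {..<q}))"
    by simp
  ultimately have "image_mset d (mset_set {..<q}) = image_mset e (mset_set {..<q})"
    by (metis less_irrefl mset_subset_size subset_mset.le_less)
  then show ?thesis
    using image_mset_eq_implies_permutes[of "{..<q}" d e] by (metis finite_lessThan lessThan_iff)
qed

lemma hyperbolic_decomposition_unique:
  fixes G :: "'a :: star_division mat"
  assumes qp: "q \<le> p" and dec: "hyperbolic_decomposition p q G \<theta> U Gp Gq"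
    and dec': "hyperbolic_decomposition p q G \<theta>' U' Gp' Gq'"
  shows "eq_up_to_order_and_signs q \<theta> \<theta>'"
proof -
  define n where "n = p + q"
  define H :: "real \<Rightarrow> 'a mat" where "H r = hyperbolic_mat p q (\<lambda>i. r * \<theta> i)" for r
  define H' :: "real \<Rightarrow> 'a mat" where "H' r = hyperbolic_mat p q (\<lambda>i. r * \<theta>' i)" for r
  have cH: "H r \<in> carrier_mat n n" "H' r \<in> carrier_mat n n" for r
    by (simp_all add: H_def H'_def n_def hyperbolic_mat_carrier[OF qp])
  have [simp]: "dim_row (H r) = n" "dim_col (H r) = n" "dim_row (H' r) = n" "dim_col (H' r) = n" for r
    using cH by (auto dest: carrier_matD)
  have H_mult: "H r * H s = H (r + s)" "H' r * H' s = H' (r + s)" for r s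
    by (simp_all add: H_def H'_def hyperbolic_mat_mult[OF qp] distrib_right)
  have H_0: "H 0 = 1\<^sub>m n" "H' 0 = 1\<^sub>m n"
    by (simp_all add: H_def H'_def n_def hyperbolic_mat_0[OF qp])
  have H_conj: "conj_transpose (H r) = H r" "conj_transpose (H' r) = H' r" for r
    by (simp_all add: H_def H'_def conj_transpose_hyperbolic_mat[OF qp])
  have GL: "Gp \<in> general_linear p" "Gq \<in> general_linear q"
      "Gp' \<in> general_linear p" "Gq' \<in> general_linear q"
    using dec dec' by (auto simp: hyperbolic_decomposition_def)
  note cGL = GL[THEN general_linear_carrier]
  define K where "K = direct_sum Gp Gq"
  define K' where "K' = direct_sum Gp' Gq'"
  have U: "U \<in> carrier_mat n n" "conj_transpose U * U = 1\<^sub>m n"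
      "U' \<in> carrier_mat n n" "conj_transpose U' * U' = 1\<^sub>m n"
    and G: "G = U * H 1 * K" and G': "G = U' * H' 1 * K'"
    using dec dec' cGL
    by (auto simp: hyperbolic_decomposition_def unitary_group_def n_def H_def H'_def
      K_def K'_def direct_sum_def)
  obtain Fp where Fp: "Fp \<in> general_linear p" "Gp * Fp = 1\<^sub>m p" "Fp * Gp = 1\<^sub>m p"
    by (rule general_linear_inverse[OF GL(1)])
  obtain Fq where Fq: "Fq \<in> general_linear q" "Gq * Fq = 1\<^sub>m q" "Fq * Gq = 1\<^sub>m q"
    by (rule general_linear_inverse[OF GL(2)])
  \<comment> \<open>The transition matrix from \<open>K\<close> to \<open>K'\<close>. Its block
    diagonal form makes it commute with \<open>J\<close>, and its lower right block will carry the
    comparison of parameters.\<close>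
  define X where "X = direct_sum (Gp' * Fp) (Gq' * Fq)"
  have Xq: "Gq' * Fq \<in> general_linear q" by (rule general_linear_mult[OF GL(4) Fq(1)])
  note c = cGL general_linear_carrier[OF Fp(1)] general_linear_carrier[OF Fq(1)] cH U(1,3)
  have cK: "K \<in> carrier_mat n n" "K' \<in> carrier_mat n n"
    using c by (simp_all add: K_def K'_def n_def)
  define F where "F = direct_sum Fp Fq"
  have F: "F \<in> carrier_mat n n" "K * F = 1\<^sub>m n" "X = K' * F"
    using c Fp Fq by (simp_all add: F_def n_def K_def K'_def X_def direct_sum_mult direct_sum_one)
  have X: "X \<in> general_linear n"
    unfolding X_def n_def using general_linear_mult GL Fp Fq by (intro general_linear_direct_sum) auto
  obtain Y where Y: "Y \<in> carrier_mat n n" "X * Y = 1\<^sub>m n" "Y * X = 1\<^sub>m n"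
    using X by (auto simp: general_linear_iff)
  note cX = general_linear_carrier[OF X]
  have gram: "conj_transpose G * G = conj_transpose K * H 2 * K"
      "conj_transpose G * G = conj_transpose K' * H' 2 * K'"
  proof -
    have "conj_transpose G * G = conj_transpose K * (H 1 * (conj_transpose U * U) * H 1) * K"
      unfolding G using U(1) cK H_conj(1)[of 1] by (simp add: conj_transpose_mult mult_mat_assoc)
    then show "conj_transpose G * G = conj_transpose K * H 2 * K"
      by (simp add: U(2) right_mult_one_mat[OF cH(1)] H_mult)
    have "conj_transpose G * G = conj_transpose K' * (H' 1 * (conj_transpose U' * U') * H' 1) * K'"
      unfolding G' using U(3) cK H_conj(2)[of 1] by (simp add: conj_transpose_mult mult_mat_assoc)
    then show "conj_transpose G * G = conj_transpose K' * H' 2 * K'"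
      by (simp add: U(4) right_mult_one_mat[OF cH(2)] H_mult)
  qed
  have cong: "conj_transpose X * H' 2 * X = H 2"
  proof -
    have "conj_transpose X * H' 2 * X = conj_transpose F * (conj_transpose K' * H' 2 * K') * F"
      unfolding F(3) using F(1) cK cH(2)[of 2] by (simp add: conj_transpose_mult mult_mat_assoc)
    also have "\<dots> = conj_transpose F * (conj_transpose K * H 2 * K) * F"
      unfolding gram[symmetric] ..
    also have "\<dots> = conj_transpose (K * F) * H 2 * (K * F)"
      using F(1) cK cH(1)[of 2] by (simp add: conj_transpose_mult mult_mat_assoc)
    also have "\<dots> = H 2"
      unfolding F(2) using cH(1)[of 2] by simp
    finally show ?thesis .
  qed
  define J :: "'a mat" where "J = direct_sum (1\<^sub>m p) (- 1\<^sub>m q)"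
  have cJ: "J \<in> carrier_mat n n" by (simp add: J_def n_def)
  have JJ: "J * J = 1\<^sub>m n"
    by (simp add: J_def n_def direct_sum_mult direct_sum_one)
  have J_conj: "conj_transpose J = J"
    unfolding J_def conj_transpose_direct_sum
    by (rule arg_cong2[where f = direct_sum]) (auto simp: conjugate_minus intro!: eq_matI)
  have J_hyp: "J * hyperbolic_mat p q \<phi> * J = hyperbolic_mat p q (\<lambda>i. - \<phi> i)" for \<phi>
    unfolding hyperbolic_mat_blocks[OF qp] J_def
    by (simp add: direct_sum_mult_four_block_mat[of _ p p _ q _ q _ _ p _ q])
        (subst four_block_mat_mult_direct_sum[of _ p p _ q _ q _ _ p _ q],
          auto intro!: cong_four_block_mat eq_matI simp: real_diag_def)
  have JH: "J * H r * J = H (- r)" "J * H' r * J = H' (- r)" for r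
    by (simp_all add: H_def H'_def J_hyp)
  have JX: "J * X = X * J"
    unfolding J_def X_def using c by (simp add: direct_sum_mult)
  have JXD: "conj_transpose X * J = J * conj_transpose X"
    using arg_cong[OF JX, of conj_transpose] cX cJ by (simp add: conj_transpose_mult J_conj)
  have cong_neg: "conj_transpose X * H' (- 2) * X = H (- 2)"
  proof -
    have "conj_transpose X * H' (- 2) * X = (conj_transpose X * J) * H' 2 * (J * X)"
      unfolding JH[symmetric] using cX cJ cH(2)[of 2] by (simp add: mult_mat_assoc)
    also have "\<dots> = J * (conj_transpose X * H' 2 * X) * J"
      unfolding JX JXD using cX cJ cH(2)[of 2] by (simp add: mult_mat_assoc)
    finally show ?thesis by (simp only: cong JH)
  qed
  have cancel: "H' r * X = conj_transpose Y * Z"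
    if "conj_transpose X * H' r * X = Z" "Z \<in> carrier_mat n n" for r Z
  proof -
    have "conj_transpose Y * Z = conj_transpose (X * Y) * (H' r * X)"
      unfolding that(1)[symmetric] using cX Y(1) cH(2)[of r]
      by (simp add: conj_transpose_mult mult_mat_assoc)
    then show ?thesis using Y(2) cX cH(2)[of r] by simp
  qed
  \<comment> \<open>From congruence to similarity: the relation at \<open>- r\<close> identifies
    \<open>H' r\<close> times the inverse adjoint of \<open>X\<close> with \<open>X * H r\<close>,
    and inserting this into the relation at \<open>r\<close> removes all adjoints.\<close>
  have twice: "H' (r + r) * X = X * H (r + r)"
    if r: "conj_transpose X * H' r * X = H r" and mr: "conj_transpose X * H' (- r) * X = H (- r)" for r
  proof -
    have "X = H' (r + - r) * X" using cX by (simp add: H_0)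
    also have "\<dots> = H' r * (H' (- r) * X)"
      unfolding H_mult(2)[symmetric] using cH(2)[of r] cH(2)[of "- r"] cX by (simp add: mult_mat_assoc)
    also have "\<dots> = H' r * (conj_transpose Y * H (- r))"
      by (simp only: cancel[OF mr cH(1)])
    finally have "X * H r = H' r * (conj_transpose Y * H (- r)) * H r" by simp
    also have "\<dots> = H' r * (conj_transpose Y * (H (- r) * H r))"
      using cH(1)[of r] cH(2)[of r] cH(1)[of "- r"] Y(1) by (simp add: mult_mat_assoc)
    also have "\<dots> = H' r * conj_transpose Y"
      using Y(1) by (simp add: H_mult H_0 right_mult_one_mat[of _ n n])
    finally have *: "X * H r = H' r * conj_transpose Y" .
    have "H' (r + r) * X = H' r * (H' r * X)"
      unfolding H_mult(2)[symmetric] using cH(2)[of r] cX by (simp add: mult_mat_assoc)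
    also have "\<dots> = H' r * conj_transpose Y * H r"
      unfolding cancel[OF r cH(1)] using cH(1)[of r] cH(2)[of r] Y(1) by (simp add: mult_mat_assoc)
    also have "\<dots> = X * (H r * H r)"
      unfolding *[symmetric] using cH(1)[of r] cX by (simp add: mult_mat_assoc)
    finally show ?thesis by (simp only: H_mult)
  qed
  have sim: "H' 4 * X = X * H 4" "H' (- 4) * X = X * H (- 4)"
    using twice[of 2] twice[of "- 2"] cong cong_neg by simp_all
  \<comment> \<open>The diagonal blocks of the sum of the hyperbolic matrices for
    \<open>4 * \<phi>\<close> and \<open>- 4 * \<phi>\<close>; the sinh blocks cancel.\<close>
  define C where "C m \<phi> = (real_diag m m (\<lambda>i. if i < q then 2 * cosh (4 * \<phi> i) else 2) :: 'a mat)"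
    for m :: nat and \<phi> :: "nat \<Rightarrow> real"
  have cC: "C m \<phi> \<in> carrier_mat m m" for m \<phi> by (simp add: C_def)
  have hyp_sum: "hyperbolic_mat p q (\<lambda>i. 4 * \<phi> i) + hyperbolic_mat p q (\<lambda>i. - 4 * \<phi> i) =
      direct_sum (C p \<phi>) (C q \<phi>)" for \<phi>
    unfolding hyperbolic_mat_blocks[OF qp] direct_sum_def C_def
    by (subst add_four_block_mat[of _ p p _ q _ q])
      (auto intro!: cong_four_block_mat real_diag_cong simp: real_diag_add real_diag_zero)
  have "direct_sum (C p \<theta>') (C q \<theta>') * X = X * direct_sum (C p \<theta>) (C q \<theta>)"
  proof -
    have "(H' 4 + H' (- 4)) * X = X * (H 4 + H (- 4))"
      using sim add_mult_distrib_mat[OF cH(2) cH(2) cX] mult_add_distrib_mat[OF cX cH(1) cH(1)]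
      by simp
    then show ?thesis by (simp only: H_def H'_def hyp_sum)
  qed
  then have ds: "direct_sum (C p \<theta>' * (Gp' * Fp)) (C q \<theta>' * (Gq' * Fq)) =
      direct_sum ((Gp' * Fp) * C p \<theta>) ((Gq' * Fq) * C q \<theta>)"
    unfolding X_def using c by (simp add: direct_sum_mult C_def)
  have "cosh (4 * \<theta>' i) = cosh (4 * \<theta> j)"
    if ij: "i < q" "j < q" and nz: "(Gq' * Fq) $$ (i, j) \<noteq> 0" for i j
  proof -
    have mult: "(real_diag q q a * Z) $$ (i, j) = of_real (a i) * Z $$ (i, j)"
      "(Z * real_diag q q a) $$ (i, j) = of_real (a j) * Z $$ (i, j)"
      if "Z \<in> carrier_mat q q" for Z :: "'a mat" and a
    proof -
      have eq: "real_diag q q a = mat_diag q (\<lambda>i. of_real (a i))"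
        by (rule eq_matI) (auto simp: real_diag_def mat_diag_def)
      show "(real_diag q q a * Z) $$ (i, j) = of_real (a i) * Z $$ (i, j)"
        unfolding eq mat_diag_mult_left[OF that] using ij by simp
      show "(Z * real_diag q q a) $$ (i, j) = of_real (a j) * Z $$ (i, j)"
        unfolding eq mat_diag_mult_right[OF that] using ij by (simp add: of_real_def)
    qed
    \<comment> \<open>Only the lower right block is compared: there each parameter occurs exactly
      once, and the entries 2 of the middle block do not interfere.\<close>
    have "(C q \<theta>' * (Gq' * Fq)) $$ (i, j) = ((Gq' * Fq) * C q \<theta>) $$ (i, j)"
      using arg_cong[OF ds, of "\<lambda>M. M $$ (p + i, p + j)"] ij c
      by (simp add: direct_sum_def C_def del: index_mult_mat(1))
    \<comment> \<open>Centrality of the reals puts both diagonal factors to the left of the same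
      nonzero entry, which can then be cancelled.\<close>
    then have "of_real (2 * cosh (4 * \<theta>' i)) * (Gq' * Fq) $$ (i, j) =
        of_real (2 * cosh (4 * \<theta> j)) * (Gq' * Fq) $$ (i, j)"
      unfolding C_def using mult[OF general_linear_carrier[OF Xq]] ij by simp
    then have "(of_real (2 * cosh (4 * \<theta>' i)) :: 'a) = of_real (2 * cosh (4 * \<theta> j))"
      using nz mult_right_cancel by blast
    then have "2 * cosh (4 * \<theta>' i) = 2 * cosh (4 * \<theta> j)"
      by (simp only: of_real_eq_iff)
    then show ?thesis by simp
  qed
  then obtain \<pi> where "\<pi> permutes {..<q}" "\<forall>i<q. cosh (4 * \<theta>' i) = cosh (4 * \<theta> (\<pi> i))"
    using support_permutes[OF Xq, of "\<lambda>i. cosh (4 * \<theta>' i)" "\<lambda>j. cosh (4 * \<theta> j)"] by blast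
  \<comment> \<open>On the reals, cosh determines its argument up to sign, which gives the two
    alternatives.\<close>
  then show ?thesis
    unfolding eq_up_to_order_and_signs_def by (intro exI[of _ \<pi>]) (auto simp: abs_eq_iff)
qed

lemma hyperbolic_decomposition_exists_unique:
  fixes G :: "'a :: star_division mat"
  assumes "q \<le> p" "G \<in> general_linear (p + q)"
  shows "\<exists>\<theta>. (\<exists>U Gp Gq. hyperbolic_decomposition p q G \<theta> U Gp Gq) \<and>
    (\<forall>\<theta>' U' Gp' Gq'. hyperbolic_decomposition p q G \<theta>' U' Gp' Gq' \<longrightarrow>
       eq_up_to_order_and_signs q \<theta> \<theta>')"
  using hyperbolic_decomposition_exists[OF assms] hyperbolic_decomposition_unique[OF assms(1)] by blast

theorem theorem5p4:
  fixes n p q :: nat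
  assumes "n = p + q" and "q \<le> p"
  shows
    "(\<forall>G \<in> (general_linear n :: complex mat set).
        \<exists>\<theta> :: nat \<Rightarrow> real.
          (\<exists>U Gp Gq. hyperbolic_decomposition p q G \<theta> U Gp Gq) \<and>
          (\<forall>\<theta>' U' Gp' Gq'. hyperbolic_decomposition p q G \<theta>' U' Gp' Gq' \<longrightarrow>
             eq_up_to_order_and_signs q \<theta> \<theta>')) \<and>
     (\<forall>G \<in> (general_linear n :: quaternion mat set).
        \<exists>\<theta> :: nat \<Rightarrow> real.
          (\<exists>U Gp Gq. hyperbolic_decomposition p q G \<theta> U Gp Gq) \<and>
          (\<forall>\<theta>' U' Gp' Gq'. hyperbolic_decomposition p q G \<theta>' U' Gp' Gq' \<longrightarrow>
             eq_up_to_order_and_signs q \<theta> \<theta>'))"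
  unfolding assms(1) by (intro conjI ballI hyperbolic_decomposition_exists_unique[OF assms(2)])

end
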